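(* $$\lim_{L\to\infty}\ \limsup_{T\to\infty}\ \frac{\mathbb{E}\left[\sum_{t=L+1}^{T+L}C_t^{\pi_z}\right]}{\mathrm{OPT}(L,T)}=1,$$ where $c$, $h$ and the demand distribution $\mathcal{D}$ are held fixed.
   Context: **Model.** Constants: per-unit holding cost $h>0$, per-unit lost-demand penalty $c>0$, integer lead time $L$ and integer planning horizon $T$ with $T>L>0$. Demands $D_1,D_2,\dots$ are i.i.d. with the law $\mathcal{D}$ of a non-negative random variable $D$ which has finite third moment and is not deterministic. At the start of period $t$ there is on-hand inventory $I_t\ge 0$ and a pipeline vector $\mathbf{x}_t=(x_{1,t},\dots,x_{L,t})$ of orders placed but not yet received. In period $t$: first $x_{1,t}$ is added to inventory; then, before $D_t$ is seen, a non-negative order is placed; the pipeline is updated by $x_{i,t+1}=x_{i+1,t}$ for $1\le i\le L-1$ and $x_{L,t+1}=$ the new order; then $D_t$ is realized. Put $a^+=\max(a,0)$, $a^-=\max(-a,0)$, and $$I_{t+1}=(I_t+x_{1,t}-D_t)^+,\quad N_t=(I_t+x_{1,t}-D_t)^-,\quad C_t=hI_{t+1}+cN_t .$$ The system starts empty ($I_0=0$, $\mathbf{x}_0=\mathbf{0}$, so that also $I_1=0$, $\mathbf{x}_1=\mathbf{0}$); ordering decisions are made only in periods $1,\dots,T$ (orders in periods $T+1,\dots,T+L$ are $0$). An admissible policy is one whose order at time $t$ is a (possibly random) function only of $T,t,I_t,\mathbf{x}_t$ and $L,h,c,\mathcal{D}$ (in particular it does not depend on future demand realizations). $\Pi$ is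 the set of admissible policies, and a superscript $\pi$ denotes quantities under policy $\pi$. Define $$\mathrm{OPT}(L,T)=\inf_{\pi\in\Pi}\sum_{t=L+1}^{T+L}\mathbb{E}[C_t^\pi].$$ **Constant-order policies.** For $r\ge 0$, $I^r_\infty$ denotes a random variable distributed as $\sup_{k\ge 0}\left(kr-\sum_{i=1}^kD_i\right)$; for $r\ge\mathbb{E}[D]$ one has $\mathbb{E}[I^r_\infty]=+\infty$. For $r\in[0,\mathbb{E}[D))$, $\pi_r$ is the policy that orders the random amount $I^r_\infty+r$ (with $I^r_\infty$ drawn independently of the demands) in period $1$ and the constant $r$ in all subsequent periods in which orders are placed. Let $z=\operatorname{argmin}_{v\ge 0}\left(h\mathbb{E}[I^v_\infty]-cv\right)$ (the infimum of all minimizers if not unique); $z\in[0,\mathbb{E}[D))$. *)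

theory Defs
  imports "HOL-Probability.Probability"
begin

text \<open>
  A state is a pair \<open>(I, x)\<close> of the on-hand inventory and the pipeline vector
  \<open>(x\<^sub>1, \<dots>, x\<^sub>L)\<close>; the latter is an extensional function on \<open>{1..L}\<close>.
\<close>

type_synonym state = "real \<times> (nat \<Rightarrow> real)"

definition pipeline_space :: "nat \<Rightarrow> (nat \<Rightarrow> real) measure" where
  "pipeline_space L = Pi\<^sub>M {1..L} (\<lambda>_. borel)"

text \<open>
  The order of a randomized policy in period \<open>t\<close> is \<open>order_rule t u I x\<close>, where \<open>u\<close> is a seed with
  law \<open>seed_law t\<close>. Seeds of different periods are independent of each other and of the demands,
  so that, given the past, the law of the order depends on \<open>t\<close>, \<open>I\<close> and \<open>x\<close> only. A policy may
  depend on \<open>L\<close>, \<open>T\<close>, \<open>h\<close>, \<open>c\<close> and the demand law, all of which are fixed when the infimum over the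
  policies is taken.
\<close>

record policy =
  seed_law :: "nat \<Rightarrow> real measure"
  order_rule :: "nat \<Rightarrow> real \<Rightarrow> real \<Rightarrow> (nat \<Rightarrow> real) \<Rightarrow> real"

definition admissible :: "nat \<Rightarrow> policy \<Rightarrow> bool" where
  "admissible L \<pi> \<longleftrightarrow>
     (\<forall>t. prob_space (seed_law \<pi> t) \<and> sets (seed_law \<pi> t) = sets borel \<and>
          (\<lambda>(u, I, x). order_rule \<pi> t u I x)
            \<in> borel_measurable (borel \<Otimes>\<^sub>M borel \<Otimes>\<^sub>M pipeline_space L) \<and>
          (AE u in seed_law \<pi> t. \<forall>I\<ge>0. \<forall>x \<in> {1..L} \<rightarrow>\<^sub>E {0..}. 0 \<le> order_rule \<pi> t u I x))"

text \<open>
  A sample point is a pair \<open>(u, d)\<close> of a seed sequence and a demand sequence; the components with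
  index \<open>0\<close> are never used.
\<close>

definition sample_space ::
    "real measure \<Rightarrow> policy \<Rightarrow> ((nat \<Rightarrow> real) \<times> (nat \<Rightarrow> real)) measure" where
  "sample_space \<D> \<pi> = Pi\<^sub>M UNIV (seed_law \<pi>) \<Otimes>\<^sub>M Pi\<^sub>M UNIV (\<lambda>_. \<D>)"

definition empty_state :: "nat \<Rightarrow> state" where
  "empty_state L = (0, \<lambda>i\<in>{1..L}. 0)"

definition next_state :: "nat \<Rightarrow> real \<Rightarrow> real \<Rightarrow> state \<Rightarrow> state" where
  "next_state L q d = (\<lambda>(I, x).
     (max (I + x 1 - d) 0, \<lambda>i\<in>{1..L}. if i < L then x (i + 1) else q))"

definition placed_order ::
    "nat \<Rightarrow> policy \<Rightarrow> (nat \<Rightarrow> real) \<Rightarrow> nat \<Rightarrow> state \<Rightarrow> real" where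
  "placed_order T \<pi> u t = (\<lambda>(I, x). if t \<in> {1..T} then order_rule \<pi> t (u t) I x else 0)"

fun state_at ::
    "nat \<Rightarrow> nat \<Rightarrow> policy \<Rightarrow> (nat \<Rightarrow> real) \<times> (nat \<Rightarrow> real) \<Rightarrow> nat \<Rightarrow> state" where
  "state_at L T \<pi> (u, d) 0 = empty_state L"
| "state_at L T \<pi> (u, d) (Suc 0) = empty_state L"
| "state_at L T \<pi> (u, d) (Suc (Suc t)) =
     (let s = state_at L T \<pi> (u, d) (Suc t)
      in next_state L (placed_order T \<pi> u (Suc t) s) (d (Suc t)) s)"

definition inventory ::
    "nat \<Rightarrow> nat \<Rightarrow> policy \<Rightarrow> (nat \<Rightarrow> real) \<times> (nat \<Rightarrow> real) \<Rightarrow> nat \<Rightarrow> real" where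
  "inventory L T \<pi> \<omega> t = fst (state_at L T \<pi> \<omega> t)"

definition lost_demand ::
    "nat \<Rightarrow> nat \<Rightarrow> policy \<Rightarrow> (nat \<Rightarrow> real) \<times> (nat \<Rightarrow> real) \<Rightarrow> nat \<Rightarrow> real" where
  "lost_demand L T \<pi> \<omega> t =
     max (- (inventory L T \<pi> \<omega> t + snd (state_at L T \<pi> \<omega> t) 1 - snd \<omega> t)) 0"

definition cost ::
    "real \<Rightarrow> real \<Rightarrow> nat \<Rightarrow> nat \<Rightarrow> policy \<Rightarrow> (nat \<Rightarrow> real) \<times> (nat \<Rightarrow> real) \<Rightarrow> nat \<Rightarrow> real" where
  "cost h c L T \<pi> \<omega> t = h * inventory L T \<pi> \<omega> (t + 1) + c * lost_demand L T \<pi> \<omega> t"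

text \<open>Costs are non-negative, and expected costs may be infinite, so expectations are taken in
  \<^typ>\<open>ennreal\<close>.\<close>

definition OPT :: "real \<Rightarrow> real \<Rightarrow> real measure \<Rightarrow> nat \<Rightarrow> nat \<Rightarrow> ennreal" where
  "OPT h c \<D> L T =
     (INF \<pi>\<in>{\<pi>. admissible L \<pi>}.
        \<Sum>t=L+1..T+L. \<integral>\<^sup>+\<omega>. ennreal (cost h c L T \<pi> \<omega> t) \<partial>sample_space \<D> \<pi>)"

text \<open>
  The limiting inventory under a constant order \<open>r\<close> is \<open>sup\<^sub>k (k r - D\<^sub>1 - \<dots> - D\<^sub>k)\<close>, possibly infinite.
  Since the term for \<open>k = 0\<close> vanishes, the truncation of negative terms by \<^const>\<open>ennreal\<close>
  does not change the supremum.
\<close>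

definition I_inf :: "real \<Rightarrow> (nat \<Rightarrow> real) \<Rightarrow> ennreal" where
  "I_inf r d = (SUP k::nat. ennreal (real k * r - (\<Sum>i=1..k. d i)))"

definition expected_I_inf :: "real measure \<Rightarrow> real \<Rightarrow> ennreal" where
  "expected_I_inf \<D> r = (\<integral>\<^sup>+d. I_inf r d \<partial>Pi\<^sub>M UNIV (\<lambda>_. \<D>))"

text \<open>Only used for \<open>0 \<le> r < E[D]\<close>, where \<^const>\<open>I_inf\<close> is almost surely finite.\<close>

definition I_inf_law :: "real measure \<Rightarrow> real \<Rightarrow> real measure" where
  "I_inf_law \<D> r = distr (Pi\<^sub>M UNIV (\<lambda>_. \<D>)) borel (\<lambda>d. enn2real (I_inf r d))"

definition constant_order_policy :: "real measure \<Rightarrow> real \<Rightarrow> policy" where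
  "constant_order_policy \<D> r =
     \<lparr> seed_law = (\<lambda>t. if t = 1 then I_inf_law \<D> r else return borel 0),
       order_rule = (\<lambda>t u I x. if t = 1 then u + r else r) \<rparr>"

definition constant_order_objective :: "real \<Rightarrow> real \<Rightarrow> real measure \<Rightarrow> real \<Rightarrow> ereal" where
  "constant_order_objective h c \<D> v = ereal h * enn2ereal (expected_I_inf \<D> v) - ereal (c * v)"

definition best_constant_order :: "real \<Rightarrow> real \<Rightarrow> real measure \<Rightarrow> real" where
  "best_constant_order h c \<D> =
     Inf {v. 0 \<le> v \<and>
       (\<forall>w\<ge>0. constant_order_objective h c \<D> v \<le> constant_order_objective h c \<D> w)}"

lemma measurable_I_inf:
  assumes "sets \<D> = sets borel"
  shows "I_inf r \<in> borel_measurable (Pi\<^sub>M UNIV (\<lambda>_. \<D>))"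
proof -
  have [measurable_cong]: "sets \<D> = sets borel" by fact
  show ?thesis unfolding I_inf_def by measurable
qed

lemma admissible_constant_order_policy:
  assumes "prob_space \<D>" "sets \<D> = sets borel" "0 \<le> r"
  shows "admissible L (constant_order_policy \<D> r)"
proof -
  interpret prob_space "Pi\<^sub>M UNIV (\<lambda>_::nat. \<D>)"
    by (intro prob_space_PiM assms)
  note [measurable] = measurable_I_inf[OF assms(2)]
  have "prob_space (I_inf_law \<D> r)"
    unfolding I_inf_law_def by (rule prob_space_distr) measurable
  moreover have "AE u in I_inf_law \<D> r. 0 \<le> u + r"
    unfolding I_inf_law_def using \<open>0 \<le> r\<close> by (subst AE_distr_iff) (auto intro!: AE_I2)
  ultimately show ?thesis
    using \<open>0 \<le> r\<close> unfolding admissible_def constant_order_policy_def policy.simps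
    by (auto simp: I_inf_law_def prob_space_return)
qed

end

theory Submission
  imports Defs
begin

text \<open>
  Let \<open>S\<^sub>j\<close> be the sum of the first \<open>j\<close> demands and \<open>G\<^sub>L(v) = E max\<^sub>j\<^sub>\<le>\<^sub>L (j v - S\<^sub>j)\<close>. The inventory after period \<open>t\<close>
  is at least the sum of arrivals minus demands over any final segment of the last \<open>L\<close> periods, and
  the orders arriving there were placed before these demands were seen. Choosing the segment that is
  optimal for the constant order \<open>q\<close> hence bounds the mean inventory below by \<open>G\<^sub>L(q)\<close> plus
  a combination of the differences between the mean arrivals and \<open>q\<close>, with weights in \<open>[0,1]\<close> that
  do not depend on \<open>t\<close>. If \<open>q\<close> is the mean order of the policy, these differences cancel on
  summation over \<open>t\<close> up to boundary terms, so the cost per period of any policy is asymptotically at least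
  \<open>C\<^sub>L = min\<^sub>v (h G\<^sub>L(v) - c v) + c E[D]\<close>.

  As \<open>L\<close> grows, \<open>G\<^sub>L(v)\<close> increases to the mean of the limiting inventory, and by compactness \<open>C\<^sub>L\<close>
  increases to the cost per period of the best constant order, which \<open>\<pi>\<^sub>z\<close> attains exactly because the
  law of the limiting inventory is stationary.
\<close>

section \<open>The random walk of orders minus demands\<close>

text \<open>Steps read the sequence from index \<open>0\<close>, while \<open>I_inf\<close> sums
  demands from index \<open>1\<close>; the shift does not change the law of an i.i.d.
  sequence.\<close>

definition walk :: "real \<Rightarrow> (nat \<Rightarrow> real) \<Rightarrow> nat \<Rightarrow> real" where
  "walk v \<omega> j = real j * v - (\<Sum>i<j. \<omega> i)"

definition run_max :: "real \<Rightarrow> nat \<Rightarrow> (nat \<Rightarrow> real) \<Rightarrow> real" where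
  "run_max v n \<omega> = Max (walk v \<omega> ` {..n})"

lemma walk_0 [simp]: "walk v \<omega> 0 = 0"
  by (simp add: walk_def)

lemma walk_le_run_max: "j \<le> n \<Longrightarrow> walk v \<omega> j \<le> run_max v n \<omega>"
  unfolding run_max_def by (intro Max_ge) auto

lemma run_max_nonneg: "0 \<le> run_max v n \<omega>"
  using walk_le_run_max[of 0 n v \<omega>] by simp

lemma run_max_attained: "\<exists>j\<le>n. run_max v n \<omega> = walk v \<omega> j"
proof -
  have "run_max v n \<omega> \<in> walk v \<omega> ` {..n}"
    unfolding run_max_def by (intro Max_in) auto
  then show ?thesis
    by auto
qed

lemma run_max_mono: "m \<le> n \<Longrightarrow> run_max v m \<omega> \<le> run_max v n \<omega>"
  using run_max_attained[of m v \<omega>] walk_le_run_max[of _ n v \<omega>] by auto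

text \<open>Changing the drift moves step \<open>j\<close> of the walk by \<open>j\<close> times the
  change, and \<open>j \<le> n\<close>. This is what makes the finite-window costs continuous in
  \<open>v\<close>.\<close>

lemma run_max_lipschitz: "run_max v n \<omega> \<le> run_max w n \<omega> + real n * \<bar>v - w\<bar>"
proof -
  obtain j where j: "j \<le> n" "run_max v n \<omega> = walk v \<omega> j"
    using run_max_attained by blast
  have "walk v \<omega> j = walk w \<omega> j + real j * (v - w)"
    by (simp add: walk_def algebra_simps)
  also have "real j * (v - w) \<le> real n * \<bar>v - w\<bar>"
  proof -
    have "real j * (v - w) \<le> real j * \<bar>v - w\<bar>"
      by (intro mult_left_mono) auto
    also have "\<dots> \<le> real n * \<bar>v - w\<bar>"
      using j by (intro mult_right_mono) auto
    finally show ?thesis .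
  qed
  finally show ?thesis
    using walk_le_run_max[OF j(1), of w \<omega>] j(2) by linarith
qed

lemma run_max_eq_0:
  assumes "\<And>i. 0 \<le> \<omega> i"
  shows "run_max 0 n \<omega> = 0"
proof -
  obtain j where "run_max 0 n \<omega> = walk 0 \<omega> j"
    using run_max_attained by blast
  moreover have "0 \<le> (\<Sum>i<j. \<omega> i)"
    by (intro sum_nonneg assms)
  ultimately show ?thesis
    using run_max_nonneg[of 0 n \<omega>] by (simp add: walk_def)
qed

lemma run_max_le:
  assumes "\<And>i. 0 \<le> \<omega> i" "0 \<le> v"
  shows "run_max v n \<omega> \<le> real n * v"
  using run_max_lipschitz[of v n \<omega> 0] run_max_eq_0[of \<omega> n] assms by simp

text \<open>Replaces the supremum of the walk by an increasing limit, the form that monotone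
  convergence requires.\<close>

lemma SUP_run_max: "(SUP n. ennreal (run_max v n \<omega>)) = (SUP k. ennreal (walk v \<omega> k))"
proof (rule antisym)
  show "(SUP n. ennreal (run_max v n \<omega>)) \<le> (SUP k. ennreal (walk v \<omega> k))"
  proof (rule SUP_least)
    fix n
    show "ennreal (run_max v n \<omega>) \<le> (SUP k. ennreal (walk v \<omega> k))"
      using run_max_attained[of n v \<omega>] by (metis SUP_upper UNIV_I)
  qed
  show "(SUP k. ennreal (walk v \<omega> k)) \<le> (SUP n. ennreal (run_max v n \<omega>))"
    by (intro SUP_mono) (auto intro!: walk_le_run_max ennreal_leI exI)
qed

section \<open>The i.i.d. demand sequence and the mean running maximum\<close>

locale iid_demand =
  fixes \<D> :: "real measure"
  assumes prob_D: "prob_space \<D>"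
    and sets_D [measurable_cong]: "sets \<D> = sets borel"
    and D_nonneg: "AE x in \<D>. 0 \<le> x"
    and integrable_D: "integrable \<D> (\<lambda>x. x)"

text \<open>Supplies the product measure \<open>S\<close> of demand sequences and
  \<open>comb_seq m d d'\<close>, which follows \<open>d\<close> below index \<open>m\<close> and
  then continues with \<open>d'\<close> from its start.\<close>

sublocale iid_demand \<subseteq> sequence_space \<D>
proof -
  interpret D: prob_space \<D>
    by (rule prob_D)
  show "sequence_space \<D>"
    by unfold_locales
qed

context iid_demand
begin

definition \<mu> :: real where "\<mu> = (\<integral>x. x \<partial>\<D>)"

definition mean_run_max :: "nat \<Rightarrow> real \<Rightarrow> real" where
  "mean_run_max n v = (\<integral>\<omega>. run_max v n \<omega> \<partial>S)"

lemma measurable_walk [measurable]: "(\<lambda>\<omega>. walk v \<omega> j) \<in> borel_measurable S"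
  unfolding walk_def by measurable

lemma measurable_run_max [measurable]: "run_max v n \<in> borel_measurable S"
  unfolding run_max_def by measurable

lemma AE_S_nonneg: "AE \<omega> in S. \<forall>i. 0 \<le> \<omega> i"
  unfolding AE_all_countable using prob_D D_nonneg by (auto intro!: AE_PiM_component)

lemma distr_component: "distr S \<D> (\<lambda>\<omega>. \<omega> i) = \<D>"
  using prob_D by (intro distr_PiM_component) auto

lemma integrable_component: "integrable S (\<lambda>\<omega>. \<omega> i)"
  using integrable_distr_eq[of "\<lambda>\<omega>. \<omega> i" S \<D> "\<lambda>x. x"] integrable_D
  by (simp add: distr_component)

lemma integral_component: "(\<integral>\<omega>. \<omega> i \<partial>S) = \<mu>"
  using integral_distr[of "\<lambda>\<omega>. \<omega> i" S \<D> "\<lambda>x. x"]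
  by (simp add: distr_component \<mu>_def)

lemma \<mu>_nonneg: "0 \<le> \<mu>"
  unfolding \<mu>_def by (intro integral_nonneg_AE D_nonneg)

lemma integrable_walk: "integrable S (\<lambda>\<omega>. walk v \<omega> j)"
  unfolding walk_def by (intro Bochner_Integration.integrable_diff Bochner_Integration.integrable_sum
    integrable_component) simp

lemma integral_walk: "(\<integral>\<omega>. walk v \<omega> j \<partial>S) = real j * (v - \<mu>)"
  unfolding walk_def
  by (subst Bochner_Integration.integral_diff)
     (auto intro!: Bochner_Integration.integrable_sum integrable_component
       simp: integral_component Bochner_Integration.integral_sum integrable_component algebra_simps P.prob_space)

text \<open>With nonnegative demands and \<open>v \<ge> 0\<close> the maximum lies between
  \<open>0\<close> and \<open>n * v\<close>, so it is bounded.\<close>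

lemma integrable_run_max: "0 \<le> v \<Longrightarrow> integrable S (run_max v n)"
  using AE_S_nonneg
  by (intro P.integrable_const_bound[where B="real n * v"])
     (auto simp: run_max_nonneg intro: run_max_le)

lemma mean_run_max_mono: "0 \<le> v \<Longrightarrow> m \<le> n \<Longrightarrow> mean_run_max m v \<le> mean_run_max n v"
  unfolding mean_run_max_def by (intro integral_mono integrable_run_max run_max_mono)

lemma mean_run_max_nonneg: "0 \<le> mean_run_max n v"
  unfolding mean_run_max_def by (intro Bochner_Integration.integral_nonneg run_max_nonneg)

lemma mean_run_max_0: "mean_run_max n 0 = 0"
  unfolding mean_run_max_def using AE_S_nonneg
  by (intro integral_eq_zero_AE) (auto simp: run_max_eq_0)

lemma mean_run_max_lipschitz:
  assumes "0 \<le> v" "0 \<le> w"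
  shows "\<bar>mean_run_max n v - mean_run_max n w\<bar> \<le> real n * \<bar>v - w\<bar>"
proof -
  have "mean_run_max n v \<le> mean_run_max n w + real n * \<bar>v - w\<bar>" if "0 \<le> v" "0 \<le> w" for v w
  proof -
    have "mean_run_max n v \<le> (\<integral>\<omega>. run_max w n \<omega> + real n * \<bar>v - w\<bar> \<partial>S)"
      unfolding mean_run_max_def using that
      by (intro integral_mono integrable_run_max run_max_lipschitz
          Bochner_Integration.integrable_add) auto
    also have "\<dots> = mean_run_max n w + real n * \<bar>v - w\<bar>"
      unfolding mean_run_max_def using integrable_run_max[OF that(2)]
      by (subst Bochner_Integration.integral_add) (auto simp: P.prob_space)
    finally show ?thesis .
  qed
  from this[OF assms] this[OF assms(2,1)] show ?thesis
    by (simp add: abs_minus_commute abs_le_iff)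
qed

text \<open>Keeps only the last step of the walk. The linear growth in \<open>v\<close> with slope
  \<open>n\<close> later beats the reward \<open>c * v\<close> once
  \<open>h * n > c\<close>.\<close>

lemma mean_run_max_ge: "0 \<le> v \<Longrightarrow> real n * (v - \<mu>) \<le> mean_run_max n v"
  unfolding mean_run_max_def integral_walk[symmetric]
  by (intro integral_mono integrable_walk integrable_run_max walk_le_run_max) auto

lemma measurable_reindex: "(\<lambda>\<omega> n. \<omega> (f n)) \<in> measurable S S"
  by (rule measurable_PiM_single') (auto simp: space_PiM)

text \<open>Exchangeability: reading an i.i.d. sequence along distinct indices preserves its law. It
  is applied to index shifts and to time reversal of a window.\<close>

lemma distr_reindex: "inj f \<Longrightarrow> distr S S (\<lambda>\<omega> n. \<omega> (f n)) = S"
  using distr_PiM_reindex[of UNIV "\<lambda>_. \<D>" f UNIV] prob_D by (simp add: restrict_def)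

lemma nn_integral_reindex:
  assumes "inj f" and [measurable]: "g \<in> borel_measurable S"
  shows "(\<integral>\<^sup>+\<omega>. g (\<lambda>n. \<omega> (f n)) \<partial>S) = (\<integral>\<^sup>+\<omega>. g \<omega> \<partial>S)"
  using nn_integral_distr[of "\<lambda>\<omega> n. \<omega> (f n)" S S g]
  by (simp add: distr_reindex assms(1) measurable_reindex)

lemma integral_reindex:
  fixes g :: "_ \<Rightarrow> real"
  assumes "inj f" and [measurable]: "g \<in> borel_measurable S"
  shows "(\<integral>\<omega>. g (\<lambda>n. \<omega> (f n)) \<partial>S) = (\<integral>\<omega>. g \<omega> \<partial>S)"
  using integral_distr[of "\<lambda>\<omega> n. \<omega> (f n)" S S g]
  by (simp add: distr_reindex assms(1) measurable_reindex)

section \<open>The supremum of the walk over all steps and its mean\<close>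

definition walk_sup :: "real \<Rightarrow> (nat \<Rightarrow> real) \<Rightarrow> ennreal" where
  "walk_sup v \<omega> = (SUP k. ennreal (walk v \<omega> k))"

lemma measurable_walk_sup [measurable]: "walk_sup v \<in> borel_measurable S"
  unfolding walk_sup_def by measurable

lemma I_inf_eq_walk_sup: "I_inf v d = walk_sup v (\<lambda>n. d (Suc n))"
proof -
  have "(\<Sum>i=1..k. d i) = (\<Sum>i<k. d (Suc i))" for k
    by (simp add: sum.atLeast_Suc_atMost_Suc_shift sum.atLeast1_atMost_eq)
  then show ?thesis
    unfolding I_inf_def walk_sup_def walk_def by simp
qed

lemma nn_integral_I_inf:
  assumes [measurable]: "g \<in> borel_measurable borel"
  shows "(\<integral>\<^sup>+\<omega>. g (I_inf v \<omega>) \<partial>S) = (\<integral>\<^sup>+\<omega>. g (walk_sup v \<omega>) \<partial>S)"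
  unfolding I_inf_eq_walk_sup
  by (rule nn_integral_reindex[of Suc "\<lambda>\<omega>. g (walk_sup v \<omega>)"]) auto

lemma expected_I_inf_eq_walk_sup: "expected_I_inf \<D> v = (\<integral>\<^sup>+\<omega>. walk_sup v \<omega> \<partial>S)"
  unfolding expected_I_inf_def by (rule nn_integral_I_inf[of "\<lambda>x. x"]) simp

lemma expected_I_inf_eq_SUP:
  assumes "0 \<le> v"
  shows "expected_I_inf \<D> v = (SUP n. ennreal (mean_run_max n v))"
proof -
  have "expected_I_inf \<D> v = (\<integral>\<^sup>+\<omega>. (SUP n. ennreal (run_max v n \<omega>)) \<partial>S)"
    by (simp add: expected_I_inf_eq_walk_sup walk_sup_def SUP_run_max)
  also have "\<dots> = (SUP n. \<integral>\<^sup>+\<omega>. ennreal (run_max v n \<omega>) \<partial>S)"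
    by (intro nn_integral_monotone_convergence_SUP)
       (auto simp: incseq_def le_fun_def intro!: ennreal_leI run_max_mono)
  also have "\<dots> = (SUP n. ennreal (mean_run_max n v))"
    unfolding mean_run_max_def using assms
    by (intro SUP_cong refl nn_integral_eq_integral integrable_run_max) (auto simp: run_max_nonneg)
  finally show ?thesis .
qed

end

section \<open>Convergence of the finite-window minima\<close>

locale lost_sales = iid_demand +
  fixes h c :: real
  assumes h_pos: "h > 0" and c_pos: "c > 0"
begin

text \<open>The constant-order objective with the limiting inventory replaced by the maximum over
  \<open>n\<close> steps. The constant \<open>c * \<mu>\<close> is added only where actual costs are
  compared.\<close>

definition window_cost :: "nat \<Rightarrow> real \<Rightarrow> real" where
  "window_cost n v = h * mean_run_max n v - c * v"

lemma window_cost_mono: "0 \<le> v \<Longrightarrow> m \<le> n \<Longrightarrow> window_cost m v \<le> window_cost n v"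
  using mean_run_max_mono h_pos by (simp add: window_cost_def)

lemma window_cost_0: "window_cost n 0 = 0"
  by (simp add: window_cost_def mean_run_max_0)

lemma continuous_on_window_cost: "continuous_on {0..} (window_cost n)"
proof -
  have "(real n)-lipschitz_on {0..} (mean_run_max n)"
    using mean_run_max_lipschitz by (intro lipschitz_onI) (auto simp: dist_real_def)
  then have "continuous_on {0..} (mean_run_max n)"
    by (rule lipschitz_on_continuous_on)
  then show ?thesis
    unfolding window_cost_def by (intro continuous_intros)
qed

text \<open>The minima over a fixed compact interval increase with the window length, and a cluster
  point of the minimizers bounds every window cost by their limit \<open>m\<close>. The existence of
  this one \<open>v\<close> is the interchange of minimum and limit.\<close>

lemma window_cost_minima_converge:
  obtains l m n0 where
    "\<And>n v. n0 \<le> n \<Longrightarrow> 0 \<le> v \<Longrightarrow> l n \<le> window_cost n v"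
    "l \<longlonglongrightarrow> m"
    "\<exists>v\<ge>0. \<forall>n. window_cost n v \<le> m"
proof -
  obtain n0 :: nat where "c / h < real n0"
    using reals_Archimedean2 by blast
  then have n0: "c < h * real n0"
    using h_pos by (simp add: field_simps)
  \<comment> \<open>\<open>B\<close> is the zero in \<open>v\<close> of the lower bound
    \<open>h * real n0 * (v - \<mu>) - c * v\<close>. Beyond it the cost is at least
    \<open>0\<close>, the value at \<open>v = 0\<close>, so minimizers can be sought in
    \<open>{0..B}\<close>.\<close>
  define B where "B = h * real n0 * \<mu> / (h * real n0 - c)"
  have "0 \<le> B"
    unfolding B_def using n0 h_pos \<mu>_nonneg by simp
  have large: "0 \<le> window_cost n v" if "n0 \<le> n" "B \<le> v" for n v
  proof -
    have "0 \<le> v"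
      using that \<open>0 \<le> B\<close> by simp
    have "h * real n0 * \<mu> \<le> v * (h * real n0 - c)"
      using that n0 by (simp add: B_def pos_divide_le_eq)
    then have "0 \<le> h * (real n0 * (v - \<mu>)) - c * v"
      by (simp add: algebra_simps)
    also have "\<dots> \<le> window_cost n0 v"
      using mean_run_max_ge[OF \<open>0 \<le> v\<close>] h_pos by (simp add: window_cost_def)
    also have "\<dots> \<le> window_cost n v"
      by (intro window_cost_mono that \<open>0 \<le> v\<close>)
    finally show ?thesis .
  qed
  have "\<exists>x\<in>{0..B}. \<forall>v\<in>{0..B}. window_cost n x \<le> window_cost n v" for n
    using \<open>0 \<le> B\<close>
    by (intro continuous_attains_inf continuous_on_subset[OF continuous_on_window_cost]) auto
  then obtain x where x: "\<And>n. x n \<in> {0..B}"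
      "\<And>n v. v \<in> {0..B} \<Longrightarrow> window_cost n (x n) \<le> window_cost n v"
    by metis
  define l where "l n = window_cost n (x n)" for n
  have l_le_0: "l n \<le> 0" for n
    using x(2)[of 0 n] \<open>0 \<le> B\<close> by (simp add: l_def window_cost_0)
  have l_le: "l n \<le> window_cost n v" if "n0 \<le> n" "0 \<le> v" for n v
    using x(2)[of v n] large[of n v] l_le_0[of n] that unfolding l_def
    by (cases "v \<le> B") auto
  have "incseq l"
  proof (rule incseq_SucI)
    fix n
    have "l n \<le> window_cost n (x (Suc n))"
      unfolding l_def by (intro x)
    also have "\<dots> \<le> l (Suc n)"
      unfolding l_def using x(1)[of "Suc n"] by (intro window_cost_mono) auto
    finally show "l n \<le> l (Suc n)" .
  qed
  then obtain m where m: "l \<longlonglongrightarrow> m" "\<And>n. l n \<le> m"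
    using incseq_convergent[of l 0] l_le_0 by auto
  obtain v r where v: "v \<in> {0..B}" "strict_mono r" "(x \<circ> r) \<longlonglongrightarrow> v"
    using compact_Icc[of 0 B, unfolded compact_def] x(1) by metis
  \<comment> \<open>For fixed \<open>n\<close>, monotonicity in the window length bounds
    \<open>window_cost n\<close> at the minimizer for the longer window \<open>r k\<close> by
    \<open>m\<close>; continuity passes this to the cluster point.\<close>
  have "window_cost n v \<le> m" for n
  proof (rule LIMSEQ_le_const2)
    show "(\<lambda>k. window_cost n (x (r k))) \<longlonglongrightarrow> window_cost n v"
      using continuous_on_window_cost[of n] v x(1) unfolding continuous_on_sequentially
      by (auto simp: comp_def)
    have "window_cost n (x (r k)) \<le> m" if "n \<le> k" for k
    proof -
      have "window_cost n (x (r k)) \<le> window_cost (r k) (x (r k))"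
        using x(1)[of "r k"] seq_suble[OF v(2), of k] that by (intro window_cost_mono) auto
      also have "\<dots> \<le> m"
        using m(2)[of "r k"] by (simp add: l_def)
      finally show ?thesis .
    qed
    then show "\<exists>N. \<forall>k\<ge>N. window_cost n (x (r k)) \<le> m"
      by blast
  qed
  with v have "\<exists>v\<ge>0. \<forall>n. window_cost n v \<le> m"
    by auto
  with l_le m(1) show ?thesis
    by (rule that)
qed

text \<open>The mean limiting inventory is the supremum of the means over finite windows, so a bound
  on the possibly infinite objective amounts to real bounds for all windows.\<close>

lemma objective_le_iff:
  assumes "0 \<le> v"
  shows "constant_order_objective h c \<D> v \<le> ereal m \<longleftrightarrow> (\<forall>n. window_cost n v \<le> m)"
proof
  assume *: "constant_order_objective h c \<D> v \<le> ereal m"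
  show "\<forall>n. window_cost n v \<le> m"
  proof
    fix n
    have n: "ennreal (mean_run_max n v) \<le> expected_I_inf \<D> v"
      unfolding expected_I_inf_eq_SUP[OF assms] by (rule SUP_upper) simp
    show "window_cost n v \<le> m"
    proof (cases "expected_I_inf \<D> v")
      case (real e)
      then have "mean_run_max n v \<le> e" "h * e - c * v \<le> m"
        using n * by (auto simp: constant_order_objective_def)
      moreover from this have "h * mean_run_max n v \<le> h * e"
        using h_pos by (intro mult_left_mono) auto
      ultimately show ?thesis
        by (simp add: window_cost_def)
    next
      case top
      then show ?thesis
        using * h_pos by (simp add: constant_order_objective_def)
    qed
  qed
next
  assume *: "\<forall>n. window_cost n v \<le> m"
  have "mean_run_max n v \<le> (m + c * v) / h" for n
    using * h_pos by (simp add: window_cost_def field_simps)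
  then have le: "expected_I_inf \<D> v \<le> ennreal ((m + c * v) / h)"
    unfolding expected_I_inf_eq_SUP[OF assms] by (intro SUP_least ennreal_leI)
  \<comment> \<open>\<open>ennreal\<close> sends negative reals to \<open>0\<close>, so a real bound
    can be read off \<open>le\<close> only after its right side is known to be nonnegative.\<close>
  have nonneg: "0 \<le> (m + c * v) / h"
  proof -
    have "0 \<le> h * mean_run_max 0 v"
      using mean_run_max_nonneg[of 0 v] h_pos by simp
    then show ?thesis
      using *[rule_format, of 0] h_pos by (intro divide_nonneg_pos) (auto simp: window_cost_def)
  qed
  show "constant_order_objective h c \<D> v \<le> ereal m"
  proof (cases "expected_I_inf \<D> v")
    case (real e)
    then have "e \<le> (m + c * v) / h"
      using le nonneg by simp
    then show ?thesis
      using real h_pos by (simp add: constant_order_objective_def field_simps)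
  next
    case top
    then show ?thesis
      using le by (simp add: top_unique)
  qed
qed

text \<open>The minimizers form an intersection of closed sublevel sets of continuous window costs.
  This set is nonempty and bounded below, so its infimum is itself a minimizer.\<close>

lemma best_constant_order_limit:
  obtains l m n0 where
    "\<And>n v. n0 \<le> n \<Longrightarrow> 0 \<le> v \<Longrightarrow> l n \<le> window_cost n v"
    "l \<longlonglongrightarrow> m"
    "0 \<le> best_constant_order h c \<D>"
    "\<And>n. window_cost n (best_constant_order h c \<D>) \<le> m"
proof -
  obtain l m n0 v where l: "\<And>n v. n0 \<le> n \<Longrightarrow> 0 \<le> v \<Longrightarrow> l n \<le> window_cost n v"
    "l \<longlonglongrightarrow> m" and v: "0 \<le> v" "\<forall>n. window_cost n v \<le> m"
    using window_cost_minima_converge by metis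
  \<comment> \<open>A value below \<open>m\<close> would, through some \<open>m'\<close> in between,
    bound all late minima \<open>l n\<close> away from their limit.\<close>
  have m_le: "ereal m \<le> constant_order_objective h c \<D> w" if "0 \<le> w" for w
  proof (rule ccontr)
    assume "\<not> ?thesis"
    then obtain m' where m': "constant_order_objective h c \<D> w < ereal m'" "m' < m"
      using ereal_dense2[of "constant_order_objective h c \<D> w" "ereal m"] by (auto simp: not_le)
    then have "\<forall>n. window_cost n w \<le> m'"
      using objective_le_iff[OF that, of m'] by (simp add: less_imp_le)
    then have "\<forall>n\<ge>n0. l n \<le> m'"
      using l(1) that order_trans by meson
    then have "m \<le> m'"
      using l(2) by (intro LIMSEQ_le_const2) auto
    with m' show False
      by simp
  qed
  define Z where "Z = {v. 0 \<le> v \<and>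
    (\<forall>w\<ge>0. constant_order_objective h c \<D> v \<le> constant_order_objective h c \<D> w)}"
  have Z_eq: "Z = (\<Inter>n. {v\<in>{0..}. window_cost n v \<le> m})"
  proof -
    have "(\<forall>w\<ge>0. constant_order_objective h c \<D> u \<le> constant_order_objective h c \<D> w)
        \<longleftrightarrow> (\<forall>n. window_cost n u \<le> m)" if "0 \<le> u" for u
      using objective_le_iff[OF that, of m] objective_le_iff[OF v(1), of m] v m_le
      by (meson order_trans)
    then show ?thesis
      unfolding Z_def by auto
  qed
  have "closed Z"
    unfolding Z_eq
    by (intro closed_INT ballI continuous_on_closed_Collect_le continuous_on_window_cost
        continuous_on_const closed_atLeast)
  moreover have "v \<in> Z" "bdd_below Z"
    using v unfolding Z_eq by (auto intro!: bdd_belowI[of _ 0])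
  ultimately have "Inf Z \<in> Z"
    by (intro closed_contains_Inf) auto
  moreover have "best_constant_order h c \<D> = Inf Z"
    by (simp add: best_constant_order_def Z_def)
  ultimately have "best_constant_order h c \<D> \<in> (\<Inter>n. {v\<in>{0..}. window_cost n v \<le> m})"
    using Z_eq by simp
  then have "0 \<le> best_constant_order h c \<D>" "\<And>n. window_cost n (best_constant_order h c \<D>) \<le> m"
    by auto
  with l show ?thesis
    by (rule that)
qed

text \<open>If the mean of \<open>max 0 (\<mu> - D)\<close> vanished, demand would be almost surely
  at least its own mean, hence equal to it.\<close>

lemma mean_run_max_\<mu>_pos:
  assumes "\<not> (AE x in \<D>. x = \<mu>)"
  shows "0 < mean_run_max 1 \<mu>"
proof (rule ccontr)
  assume "\<not> ?thesis"
  then have "mean_run_max 1 \<mu> = 0"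
    using mean_run_max_nonneg[of 1 \<mu>] by simp
  then have "AE \<omega> in S. run_max \<mu> 1 \<omega> = 0"
    unfolding mean_run_max_def using integrable_run_max[OF \<mu>_nonneg]
    by (subst (asm) integral_nonneg_eq_0_iff_AE) (auto simp: run_max_nonneg)
  then have "AE \<omega> in S. \<mu> \<le> \<omega> 0"
  proof eventually_elim
    case (elim \<omega>)
    then show ?case
      using walk_le_run_max[of 1 1 \<mu> \<omega>] by (simp add: walk_def)
  qed
  then have "AE x in distr S \<D> (\<lambda>\<omega>. \<omega> 0). \<mu> \<le> x"
    by (subst AE_distr_iff) auto
  then have ge: "AE x in \<D>. \<mu> \<le> x"
    by (simp only: distr_component)
  have "integrable \<D> (\<lambda>x. x - \<mu>)"
    using integrable_D by (intro Bochner_Integration.integrable_diff) auto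
  moreover have "(\<integral>x. x - \<mu> \<partial>\<D>) = 0"
    using integrable_D prob_space.prob_space[OF prob_D]
    by (subst Bochner_Integration.integral_diff) (auto simp: \<mu>_def)
  ultimately have "AE x in \<D>. x - \<mu> = 0"
    using ge by (subst (asm) integral_nonneg_eq_0_iff_AE) auto
  with assms show False
    by simp
qed

text \<open>Keeps the ratio of costs from degenerating. Windows of length \<open>0\<close> and
  \<open>1\<close> settle \<open>z < \<mu>\<close> and \<open>z = \<mu>\<close>; for
  \<open>z > \<mu>\<close> a window with \<open>h * n > c\<close> makes holding dearer than the
  demand saved.\<close>

lemma limit_cost_pos:
  assumes "\<not> (AE x in \<D>. x = \<mu>)" "0 \<le> z" and z: "\<And>n. window_cost n z \<le> m"
  shows "0 < m + c * \<mu>"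
proof (rule linorder_cases[of z \<mu>])
  assume "z < \<mu>"
  have "- (c * z) \<le> window_cost 0 z"
    using mean_run_max_nonneg[of 0 z] h_pos by (simp add: window_cost_def)
  with z[of 0] \<open>z < \<mu>\<close> c_pos show ?thesis
    using mult_strict_left_mono[of z \<mu> c] by linarith
next
  assume "z = \<mu>"
  moreover have "0 < h * mean_run_max 1 \<mu>"
    using mean_run_max_\<mu>_pos[OF assms(1)] h_pos by simp
  ultimately show ?thesis
    using z[of 1] unfolding window_cost_def by simp
next
  assume "\<mu> < z"
  obtain n :: nat where "c / h < real n"
    using reals_Archimedean2 by blast
  then have "c * (z - \<mu>) < h * real n * (z - \<mu>)"
    using h_pos \<open>\<mu> < z\<close> by (intro mult_strict_right_mono) (auto simp: field_simps)
  moreover have "h * (real n * (z - \<mu>)) \<le> h * mean_run_max n z"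
    using mean_run_max_ge[OF \<open>0 \<le> z\<close>] h_pos by (intro mult_left_mono) auto
  ultimately show ?thesis
    using z[of n] by (simp add: window_cost_def algebra_simps)
qed

end

section \<open>The controlled inventory process\<close>

definition order_at :: "nat \<Rightarrow> nat \<Rightarrow> policy \<Rightarrow> (nat \<Rightarrow> real) \<times> (nat \<Rightarrow> real) \<Rightarrow> nat \<Rightarrow> real" where
  "order_at L T \<pi> \<omega> t = placed_order T \<pi> (fst \<omega>) t (state_at L T \<pi> \<omega> t)"

definition arrival :: "nat \<Rightarrow> nat \<Rightarrow> policy \<Rightarrow> (nat \<Rightarrow> real) \<times> (nat \<Rightarrow> real) \<Rightarrow> nat \<Rightarrow> real" where
  "arrival L T \<pi> \<omega> t = snd (state_at L T \<pi> \<omega> t) 1"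

text \<open>Periods \<open>0\<close> and \<open>1\<close> both carry the empty state, so the
  transition rule holds only from period \<open>1\<close> on.\<close>

lemma state_at_Suc:
  assumes "1 \<le> t"
  shows "state_at L T \<pi> \<omega> (Suc t) = next_state L (order_at L T \<pi> \<omega> t) (snd \<omega> t) (state_at L T \<pi> \<omega> t)"
proof -
  obtain s where "t = Suc s"
    using assms by (cases t) auto
  then show ?thesis
    by (cases \<omega>) (simp add: order_at_def Let_def)
qed

lemma inventory_Suc:
  assumes "1 \<le> t"
  shows "inventory L T \<pi> \<omega> (Suc t) = max (inventory L T \<pi> \<omega> t + arrival L T \<pi> \<omega> t - snd \<omega> t) 0"
  using assms by (simp add: inventory_def arrival_def state_at_Suc next_state_def split_beta)

lemma lost_demand_eq:
  "lost_demand L T \<pi> \<omega> t = max (- (inventory L T \<pi> \<omega> t + arrival L T \<pi> \<omega> t - snd \<omega> t)) 0"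
  by (simp add: lost_demand_def arrival_def)

text \<open>Conservation of stock, from \<open>max (- a) 0 = max a 0 - a\<close>. It makes lost
  demand linear in inventories and arrivals, so that its sum over periods telescopes.\<close>

lemma lost_demand_balance:
  assumes "1 \<le> t"
  shows "lost_demand L T \<pi> \<omega> t =
    inventory L T \<pi> \<omega> (Suc t) - inventory L T \<pi> \<omega> t - arrival L T \<pi> \<omega> t + snd \<omega> t"
  using assms by (simp add: lost_demand_eq inventory_Suc)

lemma lost_demand_nonneg: "0 \<le> lost_demand L T \<pi> \<omega> t"
  by (simp add: lost_demand_def)

lemma inventory_0: "inventory L T \<pi> \<omega> 0 = 0"
  by (cases \<omega>) (simp add: inventory_def empty_state_def)

lemma inventory_1: "inventory L T \<pi> \<omega> (Suc 0) = 0"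
  by (cases \<omega>) (simp add: inventory_def empty_state_def)

lemma inventory_nonneg: "0 \<le> inventory L T \<pi> \<omega> t"
proof (cases t)
  case (Suc s)
  then show ?thesis
    by (cases s) (auto simp: inventory_1 inventory_Suc)
qed (simp add: inventory_0)

lemma cost_nonneg: "0 < h \<Longrightarrow> 0 < c \<Longrightarrow> 0 \<le> cost h c L T \<pi> \<omega> t"
  by (simp add: cost_def inventory_nonneg lost_demand_nonneg)

text \<open>An order enters at slot \<open>L\<close> and moves down one slot per period. The guard
  says that the period \<open>t + i - (L + 1)\<close> in which it was placed is at least
  \<open>1\<close>.\<close>

lemma pipeline_eq:
  assumes "1 \<le> t" "1 \<le> i" "i \<le> L"
  shows "snd (state_at L T \<pi> \<omega> t) i = (if L + 2 \<le> t + i then order_at L T \<pi> \<omega> (t + i - Suc L) else 0)"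
  using assms
proof (induction t arbitrary: i rule: nat_induct_at_least)
  case base
  then show ?case
    by (cases \<omega>) (simp add: empty_state_def)
next
  case (Suc t)
  have "snd (state_at L T \<pi> \<omega> (Suc t)) i =
      (if i < L then snd (state_at L T \<pi> \<omega> t) (i + 1) else order_at L T \<pi> \<omega> t)"
    using Suc.prems Suc.hyps by (simp add: state_at_Suc next_state_def split_beta)
  then show ?case
    using Suc.IH[of "i + 1"] Suc.prems Suc.hyps by auto
qed

lemma arrival_eq:
  assumes "1 \<le> t" "1 \<le> L"
  shows "arrival L T \<pi> \<omega> t = (if L < t then order_at L T \<pi> \<omega> (t - L) else 0)"
  using pipeline_eq[OF assms(1) order_refl assms(2)] by (auto simp: arrival_def)

text \<open>Causality: the state in period \<open>t\<close> depends only on demands with index below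
  \<open>t\<close>, and these are kept when the sequence is replaced from \<open>m \<ge> t\<close>
  on.\<close>

lemma state_at_comb_seq:
  "t \<le> m \<Longrightarrow> state_at L T \<pi> (u, comb_seq m d d') t = state_at L T \<pi> (u, d) t"
proof (induction t)
  case (Suc t)
  then show ?case
    by (cases t) (auto simp: Let_def comb_seq_less)
qed simp

lemma order_at_comb_seq:
  "t \<le> m \<Longrightarrow> order_at L T \<pi> (u, comb_seq m d d') t = order_at L T \<pi> (u, d) t"
  by (simp add: order_at_def state_at_comb_seq)

text \<open>The lead time adds \<open>L\<close> periods to causality: what arrives in period
  \<open>t\<close> was ordered in period \<open>t - L\<close>, or is \<open>0\<close>.\<close>

lemma arrival_comb_seq:
  "1 \<le> t \<Longrightarrow> 1 \<le> L \<Longrightarrow> t \<le> m + L \<Longrightarrow>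
    arrival L T \<pi> (u, comb_seq m d d') t = arrival L T \<pi> (u, d) t"
  by (simp add: arrival_eq order_at_comb_seq)

text \<open>Truncation at \<open>0\<close> only raises the inventory; dropping it over the last
  \<open>k\<close> periods, together with the nonnegative stock before them, leaves the net
  inflow.\<close>

lemma inventory_Suc_ge:
  assumes "k \<le> t"
  shows "(\<Sum>i<k. arrival L T \<pi> \<omega> (t - i) - snd \<omega> (t - i)) \<le> inventory L T \<pi> \<omega> (Suc t)"
proof -
  have "inventory L T \<pi> \<omega> (Suc t - k) + (\<Sum>i<k. arrival L T \<pi> \<omega> (t - i) - snd \<omega> (t - i))
      \<le> inventory L T \<pi> \<omega> (Suc t)"
    using assms
  proof (induction k)
    case (Suc k)
    then have "inventory L T \<pi> \<omega> (Suc (t - k)) \<ge>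
        inventory L T \<pi> \<omega> (t - k) + arrival L T \<pi> \<omega> (t - k) - snd \<omega> (t - k)"
      by (subst inventory_Suc) auto
    with Suc show ?case
      by (simp add: Suc_diff_le)
  qed simp
  with inventory_nonneg[of L T \<pi> \<omega> "Suc t - k"] show ?thesis
    by linarith
qed

lemma measurable_next_state:
  assumes [measurable]: "q \<in> borel_measurable M" "d \<in> borel_measurable M"
    and s[measurable]: "s \<in> measurable M (borel \<Otimes>\<^sub>M pipeline_space L)" and "1 \<le> L"
  shows "(\<lambda>\<omega>. next_state L (q \<omega>) (d \<omega>) (s \<omega>)) \<in> measurable M (borel \<Otimes>\<^sub>M pipeline_space L)"
proof -
  have comp: "(\<lambda>\<omega>. snd (s \<omega>) i) \<in> borel_measurable M" if "i \<in> {1..L}" for i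
    using measurable_compose[OF measurable_compose[OF s measurable_snd],
        of "\<lambda>x. x i" borel] that unfolding pipeline_space_def by simp
  have "(\<lambda>\<omega>. \<lambda>i\<in>{1..L}. if i < L then snd (s \<omega>) (i + 1) else q \<omega>) \<in> measurable M (pipeline_space L)"
    unfolding pipeline_space_def
  proof (intro measurable_restrict)
    show "(\<lambda>\<omega>. if i < L then snd (s \<omega>) (i + 1) else q \<omega>) \<in> borel_measurable M"
      if "i \<in> {1..L}" for i
      using comp[of "i + 1"] that by (cases "i < L") auto
  qed
  moreover have "(\<lambda>\<omega>. max (fst (s \<omega>) + snd (s \<omega>) 1 - d \<omega>) 0) \<in> borel_measurable M"
    using comp[of 1] \<open>1 \<le> L\<close> by simp
  ultimately show ?thesis
    unfolding next_state_def split_beta by (intro measurable_Pair)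
qed

section \<open>Measurability, signs and independence for the controlled process\<close>

locale controlled_demand = iid_demand +
  fixes L T :: nat and \<pi> :: policy
  assumes adm: "admissible L \<pi>" and L_pos: "1 \<le> L"
begin

abbreviation U :: "(nat \<Rightarrow> real) measure" where
  "U \<equiv> Pi\<^sub>M UNIV (seed_law \<pi>)"

abbreviation Omega :: "((nat \<Rightarrow> real) \<times> (nat \<Rightarrow> real)) measure" where
  "Omega \<equiv> sample_space \<D> \<pi>"

lemma prob_space_seed_law: "prob_space (seed_law \<pi> t)"
  and sets_seed_law [measurable_cong]: "sets (seed_law \<pi> t) = sets borel"
  using adm unfolding admissible_def by blast+

sublocale U: prob_space U
  by (intro prob_space_PiM prob_space_seed_law)

sublocale US: pair_prob_space U S
  by unfold_locales

lemma sample_space_eq: "Omega = U \<Otimes>\<^sub>M S"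
  by (simp add: sample_space_def)

sublocale Omega: prob_space Omega
  unfolding sample_space_eq by unfold_locales

lemma measurable_order_rule:
  "(\<lambda>(u, I, x). order_rule \<pi> t u I x)
     \<in> borel_measurable (borel \<Otimes>\<^sub>M borel \<Otimes>\<^sub>M pipeline_space L)"
  using adm unfolding admissible_def by blast

lemma measurable_seed [measurable]: "(\<lambda>\<omega>. fst \<omega> t) \<in> borel_measurable Omega"
  unfolding sample_space_eq by measurable

lemma measurable_demand [measurable]: "(\<lambda>\<omega>. snd \<omega> t) \<in> borel_measurable Omega"
  unfolding sample_space_eq by measurable

lemma measurable_placed_order:
  assumes [measurable]: "s \<in> measurable Omega (borel \<Otimes>\<^sub>M pipeline_space L)"
  shows "(\<lambda>\<omega>. placed_order T \<pi> (fst \<omega>) t (s \<omega>)) \<in> borel_measurable Omega"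
proof -
  have "(\<lambda>\<omega>. (fst \<omega> t, s \<omega>)) \<in> measurable Omega (borel \<Otimes>\<^sub>M borel \<Otimes>\<^sub>M pipeline_space L)"
    by measurable
  from measurable_compose[OF this measurable_order_rule[of t]] show ?thesis
    by (simp add: placed_order_def split_beta)
qed

lemma measurable_state_at:
  "(\<lambda>\<omega>. state_at L T \<pi> \<omega> t) \<in> measurable Omega (borel \<Otimes>\<^sub>M pipeline_space L)"
proof -
  have init: "(\<lambda>_. empty_state L) \<in> measurable Omega (borel \<Otimes>\<^sub>M pipeline_space L)"
    by (intro measurable_const) (auto simp: empty_state_def pipeline_space_def space_pair_measure space_PiM)
  have pos: "(\<lambda>\<omega>. state_at L T \<pi> \<omega> (Suc t)) \<in> measurable Omega (borel \<Otimes>\<^sub>M pipeline_space L)" for t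
  proof (induction t)
    case 0
    have "state_at L T \<pi> \<omega> (Suc 0) = empty_state L" for \<omega>
      by (cases \<omega>) simp
    with init show ?case
      by simp
  next
    case (Suc t)
    have "state_at L T \<pi> \<omega> (Suc (Suc t)) = next_state L (placed_order T \<pi> (fst \<omega>) (Suc t)
        (state_at L T \<pi> \<omega> (Suc t))) (snd \<omega> (Suc t)) (state_at L T \<pi> \<omega> (Suc t))" for \<omega>
      by (subst state_at_Suc) (auto simp: order_at_def)
    then show ?case
      using Suc L_pos by (simp only:) (intro measurable_next_state measurable_placed_order measurable_demand)
  qed
  show ?thesis
  proof (cases t)
    case 0
    have "state_at L T \<pi> \<omega> 0 = empty_state L" for \<omega>
      by (cases \<omega>) simp
    with init 0 show ?thesis
      by simp
  qed (use pos in simp)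
qed

lemma measurable_inventory [measurable]:
  "(\<lambda>\<omega>. inventory L T \<pi> \<omega> t) \<in> borel_measurable Omega"
  unfolding inventory_def by (rule measurable_compose[OF measurable_state_at measurable_fst])

lemma measurable_arrival [measurable]:
  "(\<lambda>\<omega>. arrival L T \<pi> \<omega> t) \<in> borel_measurable Omega"
  using measurable_compose[OF measurable_compose[OF measurable_state_at measurable_snd],
      of "\<lambda>x. x 1" borel] L_pos
  unfolding pipeline_space_def arrival_def by simp

lemma measurable_lost_demand [measurable]:
  "(\<lambda>\<omega>. lost_demand L T \<pi> \<omega> t) \<in> borel_measurable Omega"
  unfolding lost_demand_eq by measurable

lemma measurable_cost [measurable]:
  "(\<lambda>\<omega>. cost h c L T \<pi> \<omega> t) \<in> borel_measurable Omega"
  unfolding cost_def by measurable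

lemma measurable_fst_Omega [measurable]: "fst \<in> measurable Omega U"
  and measurable_snd_Omega [measurable]: "snd \<in> measurable Omega S"
  unfolding sample_space_eq by measurable

lemma distr_fst_Omega: "distr Omega U fst = U"
  unfolding sample_space_eq by (rule P.distr_pair_fst)

lemma distr_snd_Omega: "distr Omega S snd = S"
proof (rule measure_eqI)
  fix A assume A: "A \<in> sets (distr Omega S snd)"
  then have *: "snd -` A \<inter> space Omega = space U \<times> A"
    using sets.sets_into_space[of A S] by (auto simp: sample_space_eq space_pair_measure)
  have "emeasure (distr Omega S snd) A = emeasure Omega (snd -` A \<inter> space Omega)"
    using A by (intro emeasure_distr measurable_snd_Omega) simp
  also have "\<dots> = emeasure (U \<Otimes>\<^sub>M S) (space U \<times> A)"
    unfolding * by (simp only: sample_space_eq)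
  also have "\<dots> = emeasure S A"
    using A by (subst P.emeasure_pair_measure_Times) (auto simp: U.emeasure_space_1)
  finally show "emeasure (distr Omega S snd) A = emeasure S A" .
qed simp

lemma AE_demand_nonneg: "AE \<omega> in Omega. \<forall>i. 0 \<le> snd \<omega> i"
proof -
  have "AE d in distr Omega S snd. \<forall>i. 0 \<le> d i"
    unfolding distr_snd_Omega by (rule AE_S_nonneg)
  from AE_distrD[OF measurable_snd_Omega this] show ?thesis .
qed

lemma AE_seed_nonneg:
  "AE \<omega> in Omega. \<forall>t. \<forall>I\<ge>0. \<forall>x \<in> {1..L} \<rightarrow>\<^sub>E {0..}. 0 \<le> order_rule \<pi> t (fst \<omega> t) I x"
proof -
  have "AE u in U. \<forall>I\<ge>0. \<forall>x \<in> {1..L} \<rightarrow>\<^sub>E {0..}. 0 \<le> order_rule \<pi> t (u t) I x" for t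
    using adm prob_space_seed_law unfolding admissible_def
    by (intro AE_PiM_component) auto
  then have "AE u in U. \<forall>t. \<forall>I\<ge>0. \<forall>x \<in> {1..L} \<rightarrow>\<^sub>E {0..}. 0 \<le> order_rule \<pi> t (u t) I x"
    by (simp add: AE_all_countable)
  then have "AE u in distr Omega U fst.
      \<forall>t. \<forall>I\<ge>0. \<forall>x \<in> {1..L} \<rightarrow>\<^sub>E {0..}. 0 \<le> order_rule \<pi> t (u t) I x"
    by (simp only: distr_fst_Omega)
  from AE_distrD[OF measurable_fst_Omega this] show ?thesis .
qed

text \<open>Admissibility promises nonnegative orders only at nonnegative states, so nonnegativity
  of the whole pipeline is carried along as an invariant, on one null set for all periods.\<close>

lemma AE_arrival_nonneg: "AE \<omega> in Omega. \<forall>t. 0 \<le> arrival L T \<pi> \<omega> t"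
  using AE_seed_nonneg
proof eventually_elim
  case (elim \<omega>)
  have init: "snd (empty_state L) \<in> {1..L} \<rightarrow>\<^sub>E {0..}"
    by (auto simp: empty_state_def)
  have pos: "snd (state_at L T \<pi> \<omega> (Suc t)) \<in> {1..L} \<rightarrow>\<^sub>E {0..}" for t
  proof (induction t)
    case 0
    with init show ?case
      by (cases \<omega>) simp
  next
    case (Suc t)
    have "0 \<le> order_at L T \<pi> \<omega> (Suc t)"
      using elim Suc inventory_nonneg[of L T \<pi> \<omega> "Suc t"]
      by (auto simp: order_at_def placed_order_def split_beta inventory_def)
    with Suc show ?case
      by (subst state_at_Suc) (auto simp: next_state_def split_beta PiE_iff Pi_iff)
  qed
  have "snd (state_at L T \<pi> \<omega> t) \<in> {1..L} \<rightarrow>\<^sub>E {0..}" for t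
    using pos init by (cases t; cases \<omega>) auto
  then show ?case
    using L_pos by (force simp: arrival_def PiE_iff)
qed

text \<open>The first order arrives in period \<open>L + 1\<close>, and it first affects the
  inventory at the start of period \<open>L + 2\<close>.\<close>

lemma AE_inventory_eq_0: "AE \<omega> in Omega. \<forall>t\<le>Suc L. inventory L T \<pi> \<omega> t = 0"
  using AE_demand_nonneg
proof eventually_elim
  case (elim \<omega>)
  have "Suc t \<le> Suc L \<Longrightarrow> inventory L T \<pi> \<omega> (Suc t) = 0" for t
  proof (induction t)
    case (Suc t)
    then have "arrival L T \<pi> \<omega> (Suc t) = 0"
      using L_pos by (simp add: arrival_eq)
    with Suc elim show ?case
      by (simp add: inventory_Suc)
  qed (simp add: inventory_1)
  then show ?case
    using inventory_0 by (metis not0_implies_Suc)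
qed

text \<open>Demands from index \<open>m\<close> on may be resampled from an independent copy, since
  splicing two i.i.d. sequences gives an i.i.d. sequence. All independence arguments about policies
  go through this identity.\<close>

lemma nn_integral_split:
  assumes [measurable]: "F \<in> borel_measurable Omega"
  shows "(\<integral>\<^sup>+\<omega>. F \<omega> \<partial>Omega) =
    (\<integral>\<^sup>+\<omega>. (\<integral>\<^sup>+d'. F (fst \<omega>, comb_seq m (snd \<omega>) d') \<partial>S) \<partial>Omega)"
proof -
  have [measurable]: "F \<in> borel_measurable (U \<Otimes>\<^sub>M S)"
    using assms by (simp add: sample_space_eq)
  have "(\<integral>\<^sup>+\<omega>. F \<omega> \<partial>Omega) = (\<integral>\<^sup>+u. (\<integral>\<^sup>+d. F (u, d) \<partial>S) \<partial>U)"
    unfolding sample_space_eq by (rule P.nn_integral_fst[symmetric]) measurable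
  also have "\<dots> = (\<integral>\<^sup>+u. (\<integral>\<^sup>+d. (\<integral>\<^sup>+d'. F (u, comb_seq m d d') \<partial>S) \<partial>S) \<partial>U)"
  proof (rule nn_integral_cong)
    fix u assume [measurable]: "u \<in> space U"
    have "(\<integral>\<^sup>+d. F (u, d) \<partial>S) = (\<integral>\<^sup>+d. F (u, d) \<partial>distr (S \<Otimes>\<^sub>M S) S (\<lambda>(\<omega>, \<omega>'). comb_seq m \<omega> \<omega>'))"
      by (simp only: PiM_comb_seq)
    also have "\<dots> = (\<integral>\<^sup>+x. F (u, comb_seq m (fst x) (snd x)) \<partial>(S \<Otimes>\<^sub>M S))"
      by (subst nn_integral_distr) (auto simp: split_beta intro!: measurable_comb_seq)
    also have "\<dots> = (\<integral>\<^sup>+d. (\<integral>\<^sup>+d'. F (u, comb_seq m d d') \<partial>S) \<partial>S)"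
      by (subst P.nn_integral_fst[symmetric]) auto
    finally show "(\<integral>\<^sup>+d. F (u, d) \<partial>S) = (\<integral>\<^sup>+d. (\<integral>\<^sup>+d'. F (u, comb_seq m d d') \<partial>S) \<partial>S)" .
  qed
  also have "\<dots> = (\<integral>\<^sup>+\<omega>. (\<integral>\<^sup>+d'. F (fst \<omega>, comb_seq m (snd \<omega>) d') \<partial>S) \<partial>Omega)"
    unfolding sample_space_eq by (subst P.nn_integral_fst[symmetric]) auto
  finally show ?thesis .
qed

text \<open>A quantity that ignores demands from \<open>m\<close> on is independent of the demand
  sequence shifted to start at \<open>m\<close>.\<close>

lemma nn_integral_mult_shift:
  fixes f :: "_ \<Rightarrow> ennreal" and g :: "_ \<Rightarrow> ennreal"
  assumes [measurable]: "f \<in> borel_measurable Omega" "g \<in> borel_measurable S"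
    and f: "\<And>u d d'. f (u, comb_seq m d d') = f (u, d)"
  shows "(\<integral>\<^sup>+\<omega>. f \<omega> * g (\<lambda>k. snd \<omega> (k + m)) \<partial>Omega) =
    (\<integral>\<^sup>+\<omega>. f \<omega> \<partial>Omega) * (\<integral>\<^sup>+d. g d \<partial>S)"
proof -
  have [measurable]: "(\<lambda>\<omega>. g (\<lambda>k. snd \<omega> (k + m))) \<in> borel_measurable Omega"
    by (rule measurable_compose[OF measurable_snd_Omega
          measurable_compose[OF measurable_reindex[of "\<lambda>k. k + m"] assms(2)]])
  have "(\<integral>\<^sup>+\<omega>. f \<omega> * g (\<lambda>k. snd \<omega> (k + m)) \<partial>Omega) =
      (\<integral>\<^sup>+\<omega>. (\<integral>\<^sup>+d'. f \<omega> * g d' \<partial>S) \<partial>Omega)"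
  proof -
    have "(\<lambda>\<omega>. f \<omega> * g (\<lambda>k. snd \<omega> (k + m))) \<in> borel_measurable Omega"
      by measurable
    from nn_integral_split[OF this, of m] show ?thesis
      by (simp only: f comb_seq_add fst_conv snd_conv prod.collapse)
  qed
  also have "\<dots> = (\<integral>\<^sup>+\<omega>. f \<omega> \<partial>Omega) * (\<integral>\<^sup>+d. g d \<partial>S)"
    by (simp add: nn_integral_cmult nn_integral_multc)
  finally show ?thesis .
qed

lemma integrable_demand: "integrable Omega (\<lambda>\<omega>. snd \<omega> t)"
  and integral_demand: "(\<integral>\<omega>. snd \<omega> t \<partial>Omega) = \<mu>"
proof -
  show "integrable Omega (\<lambda>\<omega>. snd \<omega> t)"
    using integrable_distr_eq[of snd Omega S "\<lambda>d. d t"] integrable_component[of t] by (simp add: distr_snd_Omega)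
  show "(\<integral>\<omega>. snd \<omega> t \<partial>Omega) = \<mu>"
    using integral_distr[of snd Omega S "\<lambda>d. d t"] integral_component[of t] by (simp add: distr_snd_Omega)
qed

end

section \<open>Lower bound on the cost of a policy\<close>

text \<open>Choosing the least maximizer gives a measurable selection.\<close>

definition argmax_step :: "real \<Rightarrow> nat \<Rightarrow> (nat \<Rightarrow> real) \<Rightarrow> nat" where
  "argmax_step v n \<omega> = (LEAST j. j \<le> n \<and> walk v \<omega> j = run_max v n \<omega>)"

lemma argmax_step: "argmax_step v n \<omega> \<le> n" "walk v \<omega> (argmax_step v n \<omega>) = run_max v n \<omega>"
proof -
  have "\<exists>j. j \<le> n \<and> walk v \<omega> j = run_max v n \<omega>"
    using run_max_attained[of n v \<omega>] by metis
  from LeastI_ex[OF this] show "argmax_step v n \<omega> \<le> n"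
    "walk v \<omega> (argmax_step v n \<omega>) = run_max v n \<omega>"
    unfolding argmax_step_def by auto
qed

text \<open>Sliding the range of summation back by \<open>k\<close> drops the last \<open>k\<close>
  terms, and the terms gained at the front vanish.\<close>

lemma sum_diff_shift:
  fixes a :: "nat \<Rightarrow> real"
  assumes "k < L" "\<And>s. 1 \<le> s \<Longrightarrow> s \<le> L \<Longrightarrow> a s = 0"
  shows "(\<Sum>t=Suc L..L + n. a t) - (\<Sum>t=Suc L..L + n. a (t - k)) = (\<Sum>j<k. a (L + n - j))"
proof (induction n)
  case 0
  then show ?case
    using assms by (simp add: sum.neutral)
next
  case (Suc n)
  have "(\<Sum>j<k. a (L + Suc n - j)) - (\<Sum>j<k. a (L + n - j)) =
      (\<Sum>j<k. a (L + Suc n - j) - a (L + Suc n - Suc j))"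
    by (simp add: sum_subtractf)
  also have "\<dots> = a (L + Suc n) - a (L + Suc n - k)"
    using sum_lessThan_telescope'[of "\<lambda>j. a (L + Suc n - j)" k] by simp
  finally show ?case
    using Suc by simp
qed

section \<open>Weights from the law of the maximizing step\<close>

context iid_demand
begin

text \<open>The weight carried by the mean arrival of \<open>k\<close> periods ago: the probability
  that the maximizing segment reaches beyond it.\<close>

definition argmax_tail :: "real \<Rightarrow> nat \<Rightarrow> nat \<Rightarrow> real" where
  "argmax_tail v n k = (\<integral>\<omega>. of_bool (k < argmax_step v n \<omega>) \<partial>S)"

lemma measurable_argmax_step: "argmax_step v n \<in> measurable S (count_space UNIV)"
  unfolding argmax_step_def
proof (rule measurable_Least)
  fix j
  have "Measurable.pred S (\<lambda>\<omega>. walk v \<omega> j = run_max v n \<omega>)"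
    unfolding pred_def by (intro borel_measurable_eq measurable_walk measurable_run_max)
  then show "(\<lambda>\<omega>. j \<le> n \<and> walk v \<omega> j = run_max v n \<omega>) \<in> measurable S (count_space UNIV)"
    by (rule pred_intros_conj1')
qed

lemma measurable_argmax_less [measurable]:
  "(\<lambda>\<omega>. of_bool (k < argmax_step v n \<omega>) :: real) \<in> borel_measurable S"
  by (rule measurable_compose[OF measurable_argmax_step]) simp

lemma integrable_argmax_less: "integrable S (\<lambda>\<omega>. of_bool (k < argmax_step v n \<omega>) :: real)"
  by (rule P.integrable_const_bound[where B=1]) (auto intro: measurable_argmax_less)

lemma argmax_tail_nonneg: "0 \<le> argmax_tail v n k"
  unfolding argmax_tail_def by (intro Bochner_Integration.integral_nonneg) simp

lemma argmax_tail_le_1: "argmax_tail v n k \<le> 1"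
proof -
  have "argmax_tail v n k \<le> (\<integral>\<omega>. 1 \<partial>S)"
    unfolding argmax_tail_def by (intro integral_mono integrable_argmax_less) auto
  then show ?thesis
    by (simp add: P.prob_space)
qed

end

context controlled_demand
begin

lemma
  fixes g :: "(nat \<Rightarrow> real) \<Rightarrow> real"
  assumes "inj f" and g: "integrable S g"
  shows integrable_Omega_reindex: "integrable Omega (\<lambda>\<omega>. g (\<lambda>k. snd \<omega> (f k)))"
    and integral_Omega_reindex: "(\<integral>\<omega>. g (\<lambda>k. snd \<omega> (f k)) \<partial>Omega) = (\<integral>\<omega>. g \<omega> \<partial>S)"
proof -
  have [measurable]: "g \<in> borel_measurable S"
    using g by (rule borel_measurable_integrable)
  have m: "(\<lambda>\<omega> k. \<omega> (f k)) \<in> measurable S S"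
    by (rule measurable_reindex)
  have gm: "(\<lambda>\<omega>. g (\<lambda>k. \<omega> (f k))) \<in> borel_measurable S"
    by (rule measurable_compose[OF m]) measurable
  have "integrable S (\<lambda>\<omega>. g (\<lambda>k. \<omega> (f k)))"
    using integrable_distr_eq[OF m, of g] g by (simp add: distr_reindex assms(1))
  then show "integrable Omega (\<lambda>\<omega>. g (\<lambda>k. snd \<omega> (f k)))"
    using integrable_distr_eq[OF measurable_snd_Omega gm] by (simp only: distr_snd_Omega)
  show "(\<integral>\<omega>. g (\<lambda>k. snd \<omega> (f k)) \<partial>Omega) = (\<integral>\<omega>. g \<omega> \<partial>S)"
    using integral_distr[OF measurable_snd_Omega gm] integral_reindex[OF assms(1), of g]
    by (simp only: distr_snd_Omega) simp
qed

text \<open>Reads the demands of the window of \<open>L\<close> periods ending in \<open>t\<close> backwards in time; the values at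
  \<open>k \<ge> L\<close> only serve to keep the map injective.\<close>

definition backward :: "nat \<Rightarrow> nat \<Rightarrow> nat" where
  "backward t k = (if k < L then L - 1 - k else k) + (t + 1 - L)"

lemma backward: "L \<le> t \<Longrightarrow> k < L \<Longrightarrow> backward t k = t - k"
  by (auto simp: backward_def)

lemma inj_backward: "inj (backward t)"
  unfolding backward_def by (intro injI) (auto split: if_splits)

text \<open>Applies the segment bound with the random length that maximizes the backward walk with
  drift \<open>q\<close>. Adding and subtracting \<open>q\<close> per period isolates the running
  maximum; the indicators turn the random range into a fixed one.\<close>

lemma inventory_ge_argmax:
  assumes "L \<le> t"
  defines "w \<equiv> \<lambda>\<omega> k. snd \<omega> (backward t k)"
  shows "run_max q L (w \<omega>) + (\<Sum>k<L. of_bool (k < argmax_step q L (w \<omega>)) * (arrival L T \<pi> \<omega> (t - k) - q))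
    \<le> inventory L T \<pi> \<omega> (Suc t)"
proof -
  define J where "J = argmax_step q L (w \<omega>)"
  have J: "J \<le> L"
    unfolding J_def by (rule argmax_step)
  have "run_max q L (w \<omega>) = real J * q - (\<Sum>i<J. w \<omega> i)"
    using argmax_step(2)[of q "w \<omega>" L] by (simp add: J_def walk_def)
  also have "(\<Sum>i<J. w \<omega> i) = (\<Sum>i<J. snd \<omega> (t - i))"
    using J assms(1) by (intro sum.cong) (auto simp: w_def backward)
  finally have 1: "run_max q L (w \<omega>) = real J * q - (\<Sum>i<J. snd \<omega> (t - i))" .
  have "(\<Sum>k<L. of_bool (k < J) * (arrival L T \<pi> \<omega> (t - k) - q)) =
      (\<Sum>k<J. of_bool (k < J) * (arrival L T \<pi> \<omega> (t - k) - q))"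
    using J by (intro sum.mono_neutral_right) auto
  also have "\<dots> = (\<Sum>k<J. arrival L T \<pi> \<omega> (t - k)) - real J * q"
    by (simp add: sum_subtractf)
  finally show ?thesis
    using inventory_Suc_ge[of J t L T \<pi> \<omega>] J assms(1) 1
    unfolding J_def[symmetric] by (simp add: sum_subtractf)
qed

text \<open>Orders arriving in the window of the last \<open>L\<close> periods were placed before
  any demand of that window, whereas the maximizing step depends only on the window. Hence the mean
  of the product factorizes.\<close>

lemma
  assumes t: "L \<le> t" "k < L" and int: "integrable Omega (\<lambda>\<omega>. arrival L T \<pi> \<omega> (t - k))"
  defines "w \<equiv> \<lambda>\<omega> k. snd \<omega> (backward t k)"
  shows integrable_argmax_arrival:
      "integrable Omega (\<lambda>\<omega>. of_bool (k < argmax_step q L (w \<omega>)) * arrival L T \<pi> \<omega> (t - k))"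
    and integral_argmax_arrival:
      "(\<integral>\<omega>. of_bool (k < argmax_step q L (w \<omega>)) * arrival L T \<pi> \<omega> (t - k) \<partial>Omega) =
        argmax_tail q L k * (\<integral>\<omega>. arrival L T \<pi> \<omega> (t - k) \<partial>Omega)"
proof -
  \<comment> \<open>\<open>m\<close> is the first period of the window, and \<open>rv\<close>
    reverses the window after shifting it to start at \<open>0\<close>.\<close>
  define m where "m = t + 1 - L"
  define rv where "rv = (\<lambda>k. if k < L then L - 1 - k else k)"
  define g where "g = (\<lambda>d. ennreal (of_bool (k < argmax_step q L (\<lambda>k. d (rv k)))))"
  have inj_rv: "inj rv"
    unfolding rv_def by (intro injI) (auto split: if_splits)
  have w: "w \<omega> = (\<lambda>k. snd \<omega> (rv k + m))" for \<omega>
    by (simp add: w_def backward_def rv_def m_def)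
  have g [measurable]: "g \<in> borel_measurable S"
    unfolding g_def by (rule measurable_compose[OF measurable_reindex]) measurable
  have "(\<integral>\<^sup>+d. g d \<partial>S) = (\<integral>\<^sup>+d. ennreal (of_bool (k < argmax_step q L d)) \<partial>S)"
    unfolding g_def using inj_rv by (rule nn_integral_reindex) measurable
  also have "\<dots> = ennreal (argmax_tail q L k)"
    unfolding argmax_tail_def by (intro nn_integral_eq_integral integrable_argmax_less) auto
  finally have int_g: "(\<integral>\<^sup>+d. g d \<partial>S) = ennreal (argmax_tail q L k)" .
  have nonneg: "0 \<le> (\<integral>\<omega>. arrival L T \<pi> \<omega> (t - k) \<partial>Omega)"
    using AE_arrival_nonneg by (intro integral_nonneg_AE) auto
  have "(\<integral>\<^sup>+\<omega>. ennreal (arrival L T \<pi> \<omega> (t - k)) * g (\<lambda>j. snd \<omega> (j + m)) \<partial>Omega) =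
      (\<integral>\<^sup>+\<omega>. ennreal (arrival L T \<pi> \<omega> (t - k)) \<partial>Omega) * (\<integral>\<^sup>+d. g d \<partial>S)"
  proof (rule nn_integral_mult_shift)
    show "ennreal (arrival L T \<pi> (u, comb_seq m d d') (t - k)) = ennreal (arrival L T \<pi> (u, d) (t - k))"
      for u d d'
      using t L_pos by (subst arrival_comb_seq) (auto simp: m_def)
  qed measurable
  also have "(\<integral>\<^sup>+\<omega>. ennreal (arrival L T \<pi> \<omega> (t - k)) \<partial>Omega) =
      ennreal (\<integral>\<omega>. arrival L T \<pi> \<omega> (t - k) \<partial>Omega)"
    using AE_arrival_nonneg by (intro nn_integral_eq_integral int) auto
  also have "\<dots> * (\<integral>\<^sup>+d. g d \<partial>S) =
      ennreal (argmax_tail q L k * (\<integral>\<omega>. arrival L T \<pi> \<omega> (t - k) \<partial>Omega))"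
    unfolding int_g using nonneg argmax_tail_nonneg by (simp add: ennreal_mult mult.commute)
  also have "(\<integral>\<^sup>+\<omega>. ennreal (arrival L T \<pi> \<omega> (t - k)) * g (\<lambda>j. snd \<omega> (j + m)) \<partial>Omega) =
      (\<integral>\<^sup>+\<omega>. ennreal (of_bool (k < argmax_step q L (w \<omega>)) * arrival L T \<pi> \<omega> (t - k)) \<partial>Omega)"
    by (intro nn_integral_cong) (auto simp: g_def w)
  finally have nn: "(\<integral>\<^sup>+\<omega>. ennreal (of_bool (k < argmax_step q L (w \<omega>)) * arrival L T \<pi> \<omega> (t - k)) \<partial>Omega) =
      ennreal (argmax_tail q L k * (\<integral>\<omega>. arrival L T \<pi> \<omega> (t - k) \<partial>Omega))" .
  have "(\<lambda>\<omega>. of_bool (k < argmax_step q L (w \<omega>)) :: real) \<in> borel_measurable Omega"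
    unfolding w_def using inj_backward
    by (intro borel_measurable_integrable integrable_Omega_reindex integrable_argmax_less)
  then have [measurable]: "(\<lambda>\<omega>. of_bool (k < argmax_step q L (w \<omega>)) * arrival L T \<pi> \<omega> (t - k)) \<in> borel_measurable Omega"
    by measurable
  have "AE \<omega> in Omega. 0 \<le> of_bool (k < argmax_step q L (w \<omega>)) * arrival L T \<pi> \<omega> (t - k)"
    using AE_arrival_nonneg by eventually_elim simp
  from nn_integral_eq_integrable[THEN iffD1, OF _ this _ nn] nonneg argmax_tail_nonneg
  show "integrable Omega (\<lambda>\<omega>. of_bool (k < argmax_step q L (w \<omega>)) * arrival L T \<pi> \<omega> (t - k))"
    "(\<integral>\<omega>. of_bool (k < argmax_step q L (w \<omega>)) * arrival L T \<pi> \<omega> (t - k) \<partial>Omega) =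
        argmax_tail q L k * (\<integral>\<omega>. arrival L T \<pi> \<omega> (t - k) \<partial>Omega)"
    by auto
qed

text \<open>Mean of the pathwise bound. The weights depend on \<open>q\<close>, \<open>L\<close> and
  \<open>k\<close> but not on \<open>t\<close> or the policy, which permits the summation over time
  below.\<close>

lemma mean_inventory_ge:
  assumes "L \<le> t" "0 \<le> q" "integrable Omega (\<lambda>\<omega>. inventory L T \<pi> \<omega> (Suc t))"
    and arr: "\<And>k. k < L \<Longrightarrow> integrable Omega (\<lambda>\<omega>. arrival L T \<pi> \<omega> (t - k))"
  shows "mean_run_max L q + (\<Sum>k<L. argmax_tail q L k * ((\<integral>\<omega>. arrival L T \<pi> \<omega> (t - k) \<partial>Omega) - q))
    \<le> (\<integral>\<omega>. inventory L T \<pi> \<omega> (Suc t) \<partial>Omega)"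
proof -
  define w where "w = (\<lambda>(\<omega> :: (nat \<Rightarrow> real) \<times> (nat \<Rightarrow> real)) k. snd \<omega> (backward t k))"
  note A = integrable_argmax_arrival[OF assms(1) _ arr, of _ q]
    integral_argmax_arrival[OF assms(1) _ arr, of _ q]
  note B = integrable_Omega_reindex[OF inj_backward[of t] integrable_argmax_less]
    integral_Omega_reindex[OF inj_backward[of t] integrable_argmax_less, folded argmax_tail_def]
  note C = integrable_Omega_reindex[OF inj_backward[of t] integrable_run_max[OF assms(2)]]
    integral_Omega_reindex[OF inj_backward[of t] integrable_run_max[OF assms(2)], folded mean_run_max_def]
  have intD: "integrable Omega (\<lambda>\<omega>. of_bool (k < argmax_step q L (w \<omega>)) * (arrival L T \<pi> \<omega> (t - k) - q))"
    and D: "(\<integral>\<omega>. of_bool (k < argmax_step q L (w \<omega>)) * (arrival L T \<pi> \<omega> (t - k) - q) \<partial>Omega) =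
      argmax_tail q L k * ((\<integral>\<omega>. arrival L T \<pi> \<omega> (t - k) \<partial>Omega) - q)" if "k < L" for k
    using A[OF that that] B[of k q L] unfolding right_diff_distrib w_def by auto
  have "mean_run_max L q + (\<Sum>k<L. argmax_tail q L k * ((\<integral>\<omega>. arrival L T \<pi> \<omega> (t - k) \<partial>Omega) - q)) =
    (\<integral>\<omega>. run_max q L (w \<omega>) + (\<Sum>k<L. of_bool (k < argmax_step q L (w \<omega>)) * (arrival L T \<pi> \<omega> (t - k) - q)) \<partial>Omega)"
  proof -
    have "(\<integral>\<omega>. (\<Sum>k<L. of_bool (k < argmax_step q L (w \<omega>)) * (arrival L T \<pi> \<omega> (t - k) - q)) \<partial>Omega) =
        (\<Sum>k<L. argmax_tail q L k * ((\<integral>\<omega>. arrival L T \<pi> \<omega> (t - k) \<partial>Omega) - q))"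
      using intD D by (subst Bochner_Integration.integral_sum) auto
    moreover have "integrable Omega (\<lambda>\<omega>. \<Sum>k<L. of_bool (k < argmax_step q L (w \<omega>)) * (arrival L T \<pi> \<omega> (t - k) - q))"
      using intD by (intro Bochner_Integration.integrable_sum) auto
    ultimately show ?thesis
      using C(1)[of L] C(2)[of L] unfolding w_def
      by (subst Bochner_Integration.integral_add) (simp_all only:)
  qed
  also have "\<dots> \<le> (\<integral>\<omega>. inventory L T \<pi> \<omega> (Suc t) \<partial>Omega)"
  proof (rule integral_mono)
    show "integrable Omega (\<lambda>\<omega>. run_max q L (w \<omega>) +
        (\<Sum>k<L. of_bool (k < argmax_step q L (w \<omega>)) * (arrival L T \<pi> \<omega> (t - k) - q)))"
      using C(1)[of L] intD unfolding w_def
      by (intro Bochner_Integration.integrable_add Bochner_Integration.integrable_sum) auto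
    show "run_max q L (w \<omega>) +
        (\<Sum>k<L. of_bool (k < argmax_step q L (w \<omega>)) * (arrival L T \<pi> \<omega> (t - k) - q))
      \<le> inventory L T \<pi> \<omega> (Suc t)" for \<omega>
      unfolding w_def by (rule inventory_ge_argmax[OF assms(1)])
  qed (rule assms(3))
  finally show ?thesis .
qed

end


section \<open>Summation of the bound over the planning horizon\<close>

locale controlled_lost_sales = lost_sales \<D> h c + controlled_demand \<D> L T \<pi>
  for \<D> h c L T \<pi>
begin

definition cost_expectation :: "nat \<Rightarrow> ennreal" where
  "cost_expectation t = (\<integral>\<^sup>+\<omega>. ennreal (cost h c L T \<pi> \<omega> t) \<partial>Omega)"

lemma integrable_inventory_early: "t \<le> Suc L \<Longrightarrow> integrable Omega (\<lambda>\<omega>. inventory L T \<pi> \<omega> t)"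
  and integral_inventory_early: "t \<le> Suc L \<Longrightarrow> (\<integral>\<omega>. inventory L T \<pi> \<omega> t \<partial>Omega) = 0"
proof -
  assume t: "t \<le> Suc L"
  have *: "AE \<omega> in Omega. inventory L T \<pi> \<omega> t = 0"
    using AE_inventory_eq_0 by eventually_elim (use t in auto)
  then show "integrable Omega (\<lambda>\<omega>. inventory L T \<pi> \<omega> t)"
    by (subst integrable_cong_AE[where g = "\<lambda>_. 0"]) auto
  from * show "(\<integral>\<omega>. inventory L T \<pi> \<omega> t \<partial>Omega) = 0"
    by (intro integral_eq_zero_AE)
qed

lemma arrival_early: "1 \<le> t \<Longrightarrow> t \<le> L \<Longrightarrow> arrival L T \<pi> \<omega> t = 0"
  using L_pos by (simp add: arrival_eq)

context
  assumes finite_cost: "\<And>t. t \<in> {Suc L..T + L} \<Longrightarrow> cost_expectation t < \<infinity>"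
begin

lemma integrable_cost: "t \<in> {Suc L..T + L} \<Longrightarrow> integrable Omega (\<lambda>\<omega>. cost h c L T \<pi> \<omega> t)"
  using finite_cost[of t] h_pos c_pos unfolding cost_expectation_def
  by (intro integrableI_nonneg) (auto intro: cost_nonneg)

lemma cost_expectation_eq:
  "t \<in> {Suc L..T + L} \<Longrightarrow> cost_expectation t = ennreal (\<integral>\<omega>. cost h c L T \<pi> \<omega> t \<partial>Omega)"
  unfolding cost_expectation_def using h_pos c_pos
  by (intro nn_integral_eq_integral integrable_cost) (auto intro: cost_nonneg)

lemma integrable_inventory_Suc:
  assumes "t \<in> {Suc L..T + L}"
  shows "integrable Omega (\<lambda>\<omega>. inventory L T \<pi> \<omega> (Suc t))"
proof (rule Bochner_Integration.integrable_bound)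
  show "integrable Omega (\<lambda>\<omega>. cost h c L T \<pi> \<omega> t / h)"
    using integrable_cost[OF assms] by simp
  show "AE \<omega> in Omega. norm (inventory L T \<pi> \<omega> (Suc t)) \<le> norm (cost h c L T \<pi> \<omega> t / h)"
  proof (rule AE_I2)
    fix \<omega>
    have "h * inventory L T \<pi> \<omega> (Suc t) \<le> cost h c L T \<pi> \<omega> t"
      using c_pos lost_demand_nonneg by (simp add: cost_def)
    then have "inventory L T \<pi> \<omega> (Suc t) \<le> cost h c L T \<pi> \<omega> t / h"
      using h_pos by (simp add: field_simps)
    then show "norm (inventory L T \<pi> \<omega> (Suc t)) \<le> norm (cost h c L T \<pi> \<omega> t / h)"
      using inventory_nonneg[of L T \<pi> \<omega> "Suc t"] unfolding real_norm_def by linarith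
  qed
qed measurable

lemma integrable_inventory:
  assumes "t \<le> Suc (T + L)"
  shows "integrable Omega (\<lambda>\<omega>. inventory L T \<pi> \<omega> t)"
proof (cases "t \<le> Suc L")
  case True
  then show ?thesis
    by (rule integrable_inventory_early)
next
  case False
  then obtain s where "t = Suc s" "s \<in> {Suc L..T + L}"
    using assms by (cases t) auto
  then show ?thesis
    using integrable_inventory_Suc by simp
qed

text \<open>No moments of the orders are assumed; an arrival is at most the stock left over plus the
  demand of its period.\<close>

lemma integrable_arrival:
  assumes "1 \<le> t" "t \<le> T + L"
  shows "integrable Omega (\<lambda>\<omega>. arrival L T \<pi> \<omega> t)"
proof (rule Bochner_Integration.integrable_bound)
  show "integrable Omega (\<lambda>\<omega>. inventory L T \<pi> \<omega> (Suc t) + snd \<omega> t)"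
    using assms by (intro Bochner_Integration.integrable_add integrable_inventory integrable_demand) auto
  show "AE \<omega> in Omega. norm (arrival L T \<pi> \<omega> t) \<le> norm (inventory L T \<pi> \<omega> (Suc t) + snd \<omega> t)"
    using AE_arrival_nonneg AE_demand_nonneg
  proof eventually_elim
    case (elim \<omega>)
    have "arrival L T \<pi> \<omega> t \<le> inventory L T \<pi> \<omega> (Suc t) + snd \<omega> t"
      using inventory_Suc[OF assms(1), of L T \<pi> \<omega>] inventory_nonneg[of L T \<pi> \<omega> t] by linarith
    with elim show ?case
      by (simp add: abs_of_nonneg)
  qed
qed measurable

definition mean_inv :: "nat \<Rightarrow> real" where
  "mean_inv t = (\<integral>\<omega>. inventory L T \<pi> \<omega> t \<partial>Omega)"

definition mean_arr :: "nat \<Rightarrow> real" where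
  "mean_arr t = (\<integral>\<omega>. arrival L T \<pi> \<omega> t \<partial>Omega)"

lemma integral_cost:
  assumes "t \<in> {Suc L..T + L}"
  shows "(\<integral>\<omega>. cost h c L T \<pi> \<omega> t \<partial>Omega) =
    h * mean_inv (Suc t) + c * (mean_inv (Suc t) - mean_inv t - mean_arr t + \<mu>)"
proof -
  have "1 \<le> t"
    using assms by simp
  then have "cost h c L T \<pi> \<omega> t = h * inventory L T \<pi> \<omega> (Suc t) +
      c * (inventory L T \<pi> \<omega> (Suc t) - inventory L T \<pi> \<omega> t - arrival L T \<pi> \<omega> t + snd \<omega> t)" for \<omega>
    by (simp add: cost_def lost_demand_balance)
  moreover have "integrable Omega (\<lambda>\<omega>. inventory L T \<pi> \<omega> (Suc t))"
    "integrable Omega (\<lambda>\<omega>. inventory L T \<pi> \<omega> t)" "integrable Omega (\<lambda>\<omega>. arrival L T \<pi> \<omega> t)"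
    using assms by (intro integrable_inventory integrable_arrival; simp)+
  ultimately show ?thesis
    using integrable_demand[of t] integral_demand[of t]
    by (simp add: mean_inv_def mean_arr_def)
qed

lemma mean_arr_nonneg: "0 \<le> mean_arr t"
  unfolding mean_arr_def using AE_arrival_nonneg by (intro integral_nonneg_AE) auto

lemma mean_inv_nonneg: "0 \<le> mean_inv t"
  unfolding mean_inv_def by (intro Bochner_Integration.integral_nonneg inventory_nonneg)

text \<open>Read backwards, this limits the mean arrivals of the last \<open>k\<close> periods by
  the final inventory and \<open>k * \<mu>\<close>, which controls the boundary terms.\<close>

lemma mean_inv_Suc_ge:
  assumes "k \<le> t" "t \<le> T + L"
  shows "(\<Sum>i<k. mean_arr (t - i) - \<mu>) \<le> mean_inv (Suc t)"
proof -
  have arr: "integrable Omega (\<lambda>\<omega>. arrival L T \<pi> \<omega> (t - i))" if "i < k" for i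
    using assms that by (intro integrable_arrival) auto
  have "(\<Sum>i<k. mean_arr (t - i) - \<mu>) =
      (\<integral>\<omega>. (\<Sum>i<k. arrival L T \<pi> \<omega> (t - i) - snd \<omega> (t - i)) \<partial>Omega)"
    unfolding mean_arr_def using arr integrable_demand
    by (subst Bochner_Integration.integral_sum) (auto simp: integral_demand)
  also have "\<dots> \<le> mean_inv (Suc t)"
    unfolding mean_inv_def using arr assms integrable_demand
    by (intro integral_mono Bochner_Integration.integrable_sum Bochner_Integration.integrable_diff
        integrable_inventory inventory_Suc_ge) auto
  finally show ?thesis .
qed

text \<open>With \<open>q\<close> the average arrival, the deviations delayed by \<open>k\<close>
  sum to minus the arrivals of the last \<open>k\<close> periods. Each of the \<open>L\<close>
  weights is at most \<open>1\<close>, so each delay loses at most the final inventory plus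
  \<open>L * \<mu>\<close>.\<close>

lemma sum_mean_inv_ge:
  assumes "1 \<le> n" "n \<le> T"
  defines "q \<equiv> (\<Sum>t=Suc L..L + n. mean_arr t) / real n"
  shows "real n * mean_run_max L q - real L * (mean_inv (Suc (L + n)) + real L * \<mu>)
    \<le> (\<Sum>t=Suc L..L + n. mean_inv (Suc t))"
proof -
  have "0 \<le> q"
    unfolding q_def by (intro divide_nonneg_nonneg sum_nonneg mean_arr_nonneg) auto
  have early: "mean_arr s = 0" if "1 \<le> s" "s \<le> L" for s
    unfolding mean_arr_def using that by (simp add: arrival_early)
  have loss: "- (mean_inv (Suc (L + n)) + real L * \<mu>)
      \<le> argmax_tail q L k * ((\<Sum>t=Suc L..L + n. mean_arr (t - k)) - real n * q)" if "k < L" for k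
  proof -
    have "(\<Sum>t=Suc L..L + n. mean_arr (t - k)) - real n * q = - (\<Sum>j<k. mean_arr (L + n - j))"
      using sum_diff_shift[of k L mean_arr n, OF that early] assms(1) by (simp add: q_def)
    moreover have "(\<Sum>j<k. mean_arr (L + n - j)) \<le> mean_inv (Suc (L + n)) + real k * \<mu>"
      using mean_inv_Suc_ge[of k "L + n"] that assms by (simp add: sum_subtractf)
    moreover have "real k * \<mu> \<le> real L * \<mu>"
      using that \<mu>_nonneg by (intro mult_right_mono) auto
    moreover have "argmax_tail q L k * (\<Sum>j<k. mean_arr (L + n - j)) \<le> (\<Sum>j<k. mean_arr (L + n - j))"
      using argmax_tail_nonneg argmax_tail_le_1
      by (intro mult_left_le_one_le sum_nonneg mean_arr_nonneg) auto
    ultimately show ?thesis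
      by simp
  qed
  have "real n * mean_run_max L q - real L * (mean_inv (Suc (L + n)) + real L * \<mu>) =
      real n * mean_run_max L q + (\<Sum>k<L. - (mean_inv (Suc (L + n)) + real L * \<mu>))"
    by (simp add: algebra_simps)
  also have "\<dots> \<le> real n * mean_run_max L q +
      (\<Sum>k<L. argmax_tail q L k * ((\<Sum>t=Suc L..L + n. mean_arr (t - k)) - real n * q))"
    by (intro add_left_mono sum_mono loss) auto
  also have "\<dots> = real n * mean_run_max L q +
      (\<Sum>k<L. \<Sum>t=Suc L..L + n. argmax_tail q L k * (mean_arr (t - k) - q))"
    by (simp add: sum_distrib_left[symmetric] sum_subtractf)
  \<comment> \<open>The sums may be exchanged term by term because \<open>argmax_tail q L k\<close>
    does not involve \<open>t\<close>.\<close>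
  also have "\<dots> = (\<Sum>t=Suc L..L + n. mean_run_max L q + (\<Sum>k<L. argmax_tail q L k * (mean_arr (t - k) - q)))"
    by (subst sum.swap) (simp add: sum.distrib)
  also have "\<dots> \<le> (\<Sum>t=Suc L..L + n. mean_inv (Suc t))"
    unfolding mean_inv_def mean_arr_def using assms \<open>0 \<le> q\<close>
    by (intro sum_mono mean_inventory_ge integrable_inventory integrable_arrival) auto
  finally show ?thesis .
qed

text \<open>Holding costs are bounded by the preceding estimate, while lost demand is evaluated by
  conservation of stock. Both involve the same average \<open>q\<close>, to which the bound
  \<open>C\<close> on window costs is applied.\<close>

lemma prefix_cost_ge:
  assumes "1 \<le> n" "n \<le> T" and C: "\<And>v. 0 \<le> v \<Longrightarrow> C \<le> window_cost L v + c * \<mu>"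
  shows "real n * C - h * real L * (mean_inv (Suc (L + n)) + real L * \<mu>)
    \<le> (\<Sum>t=Suc L..L + n. \<integral>\<omega>. cost h c L T \<pi> \<omega> t \<partial>Omega)"
proof -
  define q where "q = (\<Sum>t=Suc L..L + n. mean_arr t) / real n"
  have "0 \<le> q"
    unfolding q_def by (intro divide_nonneg_nonneg sum_nonneg mean_arr_nonneg) auto
  have q: "(\<Sum>t=Suc L..L + n. mean_arr t) = real n * q"
    using assms by (simp add: q_def)
  \<comment> \<open>Only the upper end remains, since the mean inventory in period
    \<open>L + 1\<close> is \<open>0\<close>.\<close>
  have tele: "(\<Sum>t=Suc L..L + n. mean_inv (Suc t) - mean_inv t) = mean_inv (Suc (L + n))"
    using sum_Suc_diff[of "Suc L" "L + n" mean_inv] integral_inventory_early[of "Suc L"]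
    by (simp add: mean_inv_def)
  have "real n * C \<le> real n * (window_cost L q + c * \<mu>)"
    by (intro mult_left_mono C \<open>0 \<le> q\<close>) auto
  then have "real n * C - h * real L * (mean_inv (Suc (L + n)) + real L * \<mu>) \<le>
      h * (real n * mean_run_max L q - real L * (mean_inv (Suc (L + n)) + real L * \<mu>))
      + c * (real n * \<mu> - real n * q)"
    by (simp add: window_cost_def algebra_simps)
  also have "\<dots> \<le> h * (\<Sum>t=Suc L..L + n. mean_inv (Suc t))
      + c * (mean_inv (Suc (L + n)) - real n * q + real n * \<mu>)"
    using sum_mean_inv_ge[OF assms(1,2)] h_pos c_pos mean_inv_nonneg[of "Suc (L + n)"]
    by (intro add_mono mult_left_mono) (auto simp: q_def)
  also have "\<dots> = (\<Sum>t=Suc L..L + n. h * mean_inv (Suc t)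
      + c * (mean_inv (Suc t) - mean_inv t - mean_arr t + \<mu>))"
    by (simp add: sum.distrib sum_distrib_left[symmetric] sum_subtractf tele[unfolded sum_subtractf] q)
  also have "\<dots> = (\<Sum>t=Suc L..L + n. \<integral>\<omega>. cost h c L T \<pi> \<omega> t \<partial>Omega)"
    using assms by (intro sum.cong refl integral_cost[symmetric]) auto
  finally show ?thesis .
qed

lemma integral_cost_nonneg: "0 \<le> (\<integral>\<omega>. cost h c L T \<pi> \<omega> t \<partial>Omega)"
  using h_pos c_pos by (intro Bochner_Integration.integral_nonneg cost_nonneg)

text \<open>Averaging over the cut-off \<open>n\<close> absorbs the inventory left over at the end of the horizon,
  which a single cut-off cannot control.\<close>

lemma total_cost_ge:
  assumes "1 \<le> K" "K \<le> T" "0 \<le> C"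
    and C: "\<And>v. 0 \<le> v \<Longrightarrow> C \<le> window_cost L v + c * \<mu>"
  shows "real K * ((real T - real K) * C - h * (real L)\<^sup>2 * \<mu>)
    \<le> (real K + real L) * (\<Sum>t=Suc L..T + L. \<integral>\<omega>. cost h c L T \<pi> \<omega> t \<partial>Omega)"
proof -
  define tot where "tot = (\<Sum>t=Suc L..T + L. \<integral>\<omega>. cost h c L T \<pi> \<omega> t \<partial>Omega)"
  \<comment> \<open>The \<open>K\<close> largest cut-offs; each exceeds \<open>T - K\<close>, so
    little of the horizon is lost.\<close>
  define N where "N = {Suc (T - K)..T}"
  have card_N: "card N = K"
    using assms by (simp add: N_def)
  have each: "(real T - real K) * C - h * (real L)\<^sup>2 * \<mu> - real L * (h * mean_inv (Suc (L + n))) \<le> tot"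
    if "n \<in> N" for n
  proof -
    have n: "1 \<le> n" "n \<le> T" "real T - real K \<le> real n"
      using that assms by (auto simp: N_def)
    have "(real T - real K) * C \<le> real n * C"
      using n assms by (intro mult_right_mono) auto
    moreover have "(\<Sum>t=Suc L..L + n. \<integral>\<omega>. cost h c L T \<pi> \<omega> t \<partial>Omega) \<le> tot"
      unfolding tot_def using n by (intro sum_mono2 integral_cost_nonneg) auto
    ultimately show ?thesis
      using prefix_cost_ge[OF n(1,2) C] by (simp add: algebra_simps power2_eq_square)
  qed
  have "h * mean_inv (Suc t) \<le> (\<integral>\<omega>. cost h c L T \<pi> \<omega> t \<partial>Omega)" if "t \<in> {Suc L..T + L}" for t
  proof -
    have "integrable Omega (\<lambda>\<omega>. h * inventory L T \<pi> \<omega> (Suc t))"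
      using that by (intro integrable_mult_right integrable_inventory) auto
    then have "(\<integral>\<omega>. h * inventory L T \<pi> \<omega> (Suc t) \<partial>Omega) \<le> (\<integral>\<omega>. cost h c L T \<pi> \<omega> t \<partial>Omega)"
      using integrable_cost[OF that] c_pos
      by (intro integral_mono) (auto simp: cost_def lost_demand_nonneg)
    then show ?thesis
      by (simp add: mean_inv_def)
  qed
  then have "(\<Sum>t\<in>(+) L ` N. h * mean_inv (Suc t)) \<le> (\<Sum>t\<in>(+) L ` N. \<integral>\<omega>. cost h c L T \<pi> \<omega> t \<partial>Omega)"
    by (intro sum_mono) (auto simp: N_def)
  also have "\<dots> \<le> tot"
    unfolding tot_def by (intro sum_mono2 integral_cost_nonneg) (auto simp: N_def)
  \<comment> \<open>The leftover inventories of different cut-offs are charged in different periods,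
    so together they cost at most the total.\<close>
  finally have left_over: "(\<Sum>n\<in>N. h * mean_inv (Suc (L + n))) \<le> tot"
    by (subst (asm) sum.reindex) auto
  have "real K * ((real T - real K) * C - h * (real L)\<^sup>2 * \<mu>) -
      real L * (\<Sum>n\<in>N. h * mean_inv (Suc (L + n))) =
      (\<Sum>n\<in>N. (real T - real K) * C - h * (real L)\<^sup>2 * \<mu> - real L * (h * mean_inv (Suc (L + n))))"
    by (simp add: sum_subtractf card_N sum_distrib_left)
  also have "\<dots> \<le> real K * tot"
    using sum_mono[of N _ "\<lambda>_. tot", OF each] by (simp add: card_N)
  finally have "real K * ((real T - real K) * C - h * (real L)\<^sup>2 * \<mu>) \<le> real K * tot + real L * tot"
    using mult_left_mono[OF left_over, of "real L"] by simp
  then show ?thesis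
    unfolding tot_def by (simp only: distrib_right)
qed

end

text \<open>Extends the bound to every policy: if some period has infinite mean cost, the right side
  is infinite.\<close>

lemma total_cost_expectation_ge:
  assumes "1 \<le> K" "K \<le> T" "0 \<le> C"
    and "\<And>v. 0 \<le> v \<Longrightarrow> C \<le> window_cost L v + c * \<mu>"
  shows "ennreal (real K * ((real T - real K) * C - h * (real L)\<^sup>2 * \<mu>) / (real K + real L))
    \<le> (\<Sum>t=Suc L..T + L. cost_expectation t)"
proof (cases "\<forall>t\<in>{Suc L..T + L}. cost_expectation t < \<infinity>")
  case True
  then have fin: "\<And>t. t \<in> {Suc L..T + L} \<Longrightarrow> cost_expectation t < \<infinity>"
    by blast
  have "(\<Sum>t=Suc L..T + L. cost_expectation t) = ennreal (\<Sum>t=Suc L..T + L. \<integral>\<omega>. cost h c L T \<pi> \<omega> t \<partial>Omega)"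
    using cost_expectation_eq[OF fin] integral_cost_nonneg[OF fin]
    by (simp add: sum_ennreal)
  then show ?thesis
    using total_cost_ge[OF fin assms] assms(1)
    by (auto intro!: ennreal_leI simp: divide_le_eq mult.commute)
next
  case False
  then have "\<exists>t\<in>{Suc L..T + L}. cost_expectation t = \<top>"
    by (metis infinity_ennreal_def less_top)
  then have "(\<Sum>t=Suc L..T + L. cost_expectation t) = \<top>"
    by simp
  then show ?thesis
    by (simp only: top_greatest)
qed

end

section \<open>Cost of a constant-order policy\<close>

lemma walk_case_nat_Suc: "walk v (case_nat x \<omega>) (Suc j) = walk v \<omega> j + v - x"
  by (simp add: walk_def sum.lessThan_Suc_shift algebra_simps del: sum.lessThan_Suc)

context iid_demand
begin

text \<open>Splitting off the first step, the supremum is either attained at step \<open>0\<close>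
  or equals \<open>v - x\<close> plus the supremum of the remaining walk. This is exactly one
  inventory update with arrival \<open>v\<close> and demand \<open>x\<close>.\<close>

lemma walk_sup_case_nat:
  assumes "walk_sup v \<omega> < \<infinity>"
  shows "walk_sup v (case_nat x \<omega>) = ennreal (max (enn2real (walk_sup v \<omega>) + v - x) 0)"
proof -
  obtain b where b: "0 \<le> b" "walk_sup v \<omega> = ennreal b"
    using assms by (cases "walk_sup v \<omega>") auto
  have le_b: "walk v \<omega> j \<le> b" for j
  proof -
    have "ennreal (walk v \<omega> j) \<le> ennreal b"
      unfolding b(2)[symmetric] walk_sup_def by (rule SUP_upper) simp
    then show ?thesis
      using b(1) by simp
  qed
  have "walk_sup v (case_nat x \<omega>) \<le> ennreal (max (b + v - x) 0)"
    unfolding walk_sup_def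
  proof (intro SUP_least ennreal_leI)
    fix k
    show "walk v (case_nat x \<omega>) k \<le> max (b + v - x) 0"
    proof (cases k)
      case (Suc j)
      show ?thesis
        using le_b[of j] unfolding Suc walk_case_nat_Suc by linarith
    qed simp
  qed
  moreover have "ennreal (max (b + v - x) 0) \<le> walk_sup v (case_nat x \<omega>)"
  proof (cases "walk_sup v (case_nat x \<omega>)")
    case (real w)
    have le_w: "walk v \<omega> j + v - x \<le> w" for j
    proof -
      have "ennreal (walk v (case_nat x \<omega>) (Suc j)) \<le> ennreal w"
        unfolding real(2)[symmetric] walk_sup_def by (rule SUP_upper) simp
      then show ?thesis
        using real(1) unfolding walk_case_nat_Suc by simp
    qed
    have "walk_sup v \<omega> \<le> ennreal (w - v + x)"
      unfolding walk_sup_def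
    proof (intro SUP_least ennreal_leI)
      show "walk v \<omega> k \<le> w - v + x" for k
        using le_w[of k] by linarith
    qed
    moreover have "0 \<le> w - v + x"
      using le_w[of 0] by simp
    ultimately have "b \<le> w - v + x"
      using b by simp
    then show ?thesis
      using real by (auto intro!: ennreal_leI)
  qed simp
  ultimately show ?thesis
    using b by simp
qed

lemma nn_integral_I_inf_law:
  assumes [measurable]: "f \<in> borel_measurable borel"
  shows "(\<integral>\<^sup>+x. f x \<partial>I_inf_law \<D> v) = (\<integral>\<^sup>+\<omega>. f (enn2real (walk_sup v \<omega>)) \<partial>S)"
proof -
  have [measurable]: "I_inf v \<in> borel_measurable S"
    by (rule measurable_I_inf[OF sets_D])
  have "(\<integral>\<^sup>+x. f x \<partial>I_inf_law \<D> v) = (\<integral>\<^sup>+\<omega>. f (enn2real (I_inf v \<omega>)) \<partial>S)"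
    unfolding I_inf_law_def by (rule nn_integral_distr) measurable
  also have "\<dots> = (\<integral>\<^sup>+\<omega>. f (enn2real (walk_sup v \<omega>)) \<partial>S)"
    by (rule nn_integral_I_inf[of "\<lambda>y. f (enn2real y)"]) measurable
  finally show ?thesis .
qed

lemma AE_walk_sup_finite:
  assumes "expected_I_inf \<D> v < \<infinity>"
  shows "AE \<omega> in S. walk_sup v \<omega> < \<infinity>"
proof -
  have "AE \<omega> in S. walk_sup v \<omega> \<noteq> \<infinity>"
    using assms unfolding expected_I_inf_eq_walk_sup
    by (intro nn_integral_PInf_AE measurable_walk_sup) auto
  then show ?thesis
    by eventually_elim (simp add: less_top)
qed

lemma nn_integral_I_inf_law_ennreal:
  assumes "expected_I_inf \<D> v < \<infinity>"
  shows "(\<integral>\<^sup>+x. ennreal x \<partial>I_inf_law \<D> v) = expected_I_inf \<D> v"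
proof -
  have "(\<integral>\<^sup>+x. ennreal x \<partial>I_inf_law \<D> v) = (\<integral>\<^sup>+\<omega>. ennreal (enn2real (walk_sup v \<omega>)) \<partial>S)"
    by (rule nn_integral_I_inf_law) measurable
  also have "\<dots> = (\<integral>\<^sup>+\<omega>. walk_sup v \<omega> \<partial>S)"
    using AE_walk_sup_finite[OF assms] by (intro nn_integral_cong_AE) (auto elim: eventually_mono)
  finally show ?thesis
    by (simp add: expected_I_inf_eq_walk_sup)
qed

text \<open>Prepending a fresh demand to an i.i.d. sequence leaves its law unchanged, while it acts
  on the supremum of the walk as one inventory update.\<close>

lemma I_inf_law_stationary:
  assumes fin: "expected_I_inf \<D> v < \<infinity>" and f [measurable]: "f \<in> borel_measurable borel"
  shows "(\<integral>\<^sup>+x. (\<integral>\<^sup>+d. f (max (x + v - d 0) 0) \<partial>S) \<partial>I_inf_law \<D> v) = (\<integral>\<^sup>+x. f x \<partial>I_inf_law \<D> v)"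
proof -
  define R where "R \<omega> = enn2real (walk_sup v \<omega>)" for \<omega>
  have R [measurable]: "R \<in> borel_measurable S"
    unfolding R_def by measurable
  have step: "AE \<omega> in S. \<forall>d. R (comb_seq 1 d \<omega>) = max (R \<omega> + v - d 0) 0"
    using AE_walk_sup_finite[OF fin]
  proof eventually_elim
    case (elim \<omega>)
    then show ?case
      unfolding R_def One_nat_def comb_seq_Suc_0
      by (simp only: walk_sup_case_nat enn2real_ennreal max.cobounded2) simp
  qed
  have "(\<integral>\<^sup>+x. f x \<partial>I_inf_law \<D> v) = (\<integral>\<^sup>+\<omega>. f (R \<omega>) \<partial>S)"
    unfolding R_def by (rule nn_integral_I_inf_law) measurable
  also have "\<dots> = (\<integral>\<^sup>+\<omega>. f (R \<omega>) \<partial>distr (S \<Otimes>\<^sub>M S) S (\<lambda>(\<omega>, \<omega>'). comb_seq 1 \<omega> \<omega>'))"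
    by (simp only: PiM_comb_seq)
  also have "\<dots> = (\<integral>\<^sup>+x. f (R (comb_seq 1 (fst x) (snd x))) \<partial>(S \<Otimes>\<^sub>M S))"
    by (subst nn_integral_distr) (auto simp: split_beta intro!: measurable_comb_seq measurable_compose[OF R f])
  also have "\<dots> = (\<integral>\<^sup>+\<omega>. (\<integral>\<^sup>+d. f (R (comb_seq 1 d \<omega>)) \<partial>S) \<partial>S)"
  proof -
    interpret SS: pair_sigma_finite S S ..
    have "(\<lambda>x. comb_seq 1 (fst x) (snd x)) \<in> measurable (S \<Otimes>\<^sub>M S) S"
      using measurable_comb_seq[of 1 \<D>] by (simp add: split_beta)
    then have "(\<lambda>x. f (R (comb_seq 1 (fst x) (snd x)))) \<in> borel_measurable (S \<Otimes>\<^sub>M S)"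
      by (rule measurable_compose[OF _ measurable_compose[OF R f]])
    from SS.nn_integral_snd[OF this] show ?thesis
      by simp
  qed
  also have "\<dots> = (\<integral>\<^sup>+\<omega>. (\<integral>\<^sup>+d. f (max (R \<omega> + v - d 0) 0) \<partial>S) \<partial>S)"
    using step by (intro nn_integral_cong_AE) (auto elim: eventually_mono)
  also have "\<dots> = (\<integral>\<^sup>+x. (\<integral>\<^sup>+d. f (max (x + v - d 0) 0) \<partial>S) \<partial>I_inf_law \<D> v)"
    unfolding R_def by (rule nn_integral_I_inf_law[symmetric]) measurable
  finally show ?thesis ..
qed

end

section \<open>The stationary inventory process under a constant order\<close>

locale constant_order_demand = lost_sales \<D> h c for \<D> h c +
  fixes L T :: nat and r M :: real
  assumes L_ge_1: "1 \<le> L" and r_nonneg: "0 \<le> r"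
    and M_nonneg: "0 \<le> M" and M_eq: "expected_I_inf \<D> r = ennreal M"

sublocale constant_order_demand \<subseteq> controlled_demand \<D> L T "constant_order_policy \<D> r"
  by unfold_locales (intro admissible_constant_order_policy prob_D sets_D r_nonneg L_ge_1)+

context constant_order_demand
begin

abbreviation \<pi> :: policy where
  "\<pi> \<equiv> constant_order_policy \<D> r"

text \<open>The level \<open>stock \<omega> n\<close> plus \<open>r\<close> is the inventory available in period \<open>L + 1 + n\<close>: the random part
  of the first order, which arrives in period \<open>L + 1\<close>, is counted as stock.\<close>

definition stock :: "(nat \<Rightarrow> real) \<times> (nat \<Rightarrow> real) \<Rightarrow> nat \<Rightarrow> real" where
  "stock \<omega> n = (if n = 0 then fst \<omega> 1 else inventory L T \<pi> \<omega> (Suc L + n))"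

lemma measurable_stock [measurable]: "(\<lambda>\<omega>. stock \<omega> n) \<in> borel_measurable Omega"
  unfolding stock_def by (cases "n = 0") simp_all

lemma arrival_constant:
  assumes "n < T"
  shows "arrival L T \<pi> \<omega> (Suc L + n) = (if n = 0 then fst \<omega> 1 + r else r)"
  using assms L_ge_1
  by (auto simp: arrival_eq order_at_def placed_order_def split_beta constant_order_policy_def)

lemma AE_available: "AE \<omega> in Omega. \<forall>n<T. inventory L T \<pi> \<omega> (Suc L + n) + arrival L T \<pi> \<omega> (Suc L + n) = stock \<omega> n + r"
  using AE_inventory_eq_0
proof eventually_elim
  case (elim \<omega>)
  then show ?case
    using arrival_constant[of _ \<omega>] by (auto simp: stock_def)
qed

lemma AE_stock_Suc: "AE \<omega> in Omega. \<forall>n<T. stock \<omega> (Suc n) = max (stock \<omega> n + r - snd \<omega> (Suc L + n)) 0"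
  using AE_available
proof eventually_elim
  case (elim \<omega>)
  show ?case
  proof (intro allI impI)
    fix n assume "n < T"
    then show "stock \<omega> (Suc n) = max (stock \<omega> n + r - snd \<omega> (Suc L + n)) 0"
      using elim inventory_Suc[of "Suc L + n" L T \<pi> \<omega>] by (auto simp: stock_def[of \<omega> "Suc n"])
  qed
qed

lemma stock_comb_seq: "stock (u, comb_seq (Suc L + n) d d') n = stock (u, d) n"
  by (simp add: stock_def inventory_def state_at_comb_seq)

text \<open>The initial stock is the seed of period \<open>1\<close>, drawn from the stationary law,
  and each later demand is independent of the stock it meets. Stating it for all test functions lets
  the induction hypothesis be used on the function averaged over one demand.\<close>

lemma nn_integral_stock:
  assumes "n \<le> T" "f \<in> borel_measurable borel"
  shows "(\<integral>\<^sup>+\<omega>. f (stock \<omega> n) \<partial>Omega) = (\<integral>\<^sup>+x. f x \<partial>I_inf_law \<D> r)"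
  using assms
proof (induction n arbitrary: f)
  case (0 f)
  note [measurable] = 0(2)
  have seed: "seed_law \<pi> 1 = I_inf_law \<D> r"
    by (simp add: constant_order_policy_def)
  have "(\<integral>\<^sup>+\<omega>. f (stock \<omega> 0) \<partial>Omega) = (\<integral>\<^sup>+u. f (u 1) \<partial>distr Omega U fst)"
    by (subst nn_integral_distr) (auto simp: stock_def)
  also have "\<dots> = (\<integral>\<^sup>+x. f x \<partial>distr U (seed_law \<pi> 1) (\<lambda>u. u 1))"
    unfolding distr_fst_Omega by (rule nn_integral_distr[symmetric]) measurable
  also have "distr U (seed_law \<pi> 1) (\<lambda>u. u 1) = seed_law \<pi> 1"
    by (intro distr_PiM_component prob_space_seed_law) auto
  finally show ?case
    by (simp only: seed)
next
  case (Suc n f)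
  note f [measurable] = Suc.prems(2)
  define m where "m = Suc L + n"
  have meas: "(\<lambda>\<omega>. f (max (stock \<omega> n + r - snd \<omega> m) 0)) \<in> borel_measurable Omega"
    by measurable
  have "(\<integral>\<^sup>+\<omega>. f (stock \<omega> (Suc n)) \<partial>Omega) = (\<integral>\<^sup>+\<omega>. f (max (stock \<omega> n + r - snd \<omega> m) 0) \<partial>Omega)"
    unfolding m_def using AE_stock_Suc Suc.prems(1)
    by (intro nn_integral_cong_AE) (auto elim!: eventually_mono)
  also have "\<dots> = (\<integral>\<^sup>+\<omega>. (\<integral>\<^sup>+d. f (max (stock \<omega> n + r - d 0) 0) \<partial>S) \<partial>Omega)"
  proof -
    have "comb_seq m d d' m = d' 0" for d d' :: "nat \<Rightarrow> real"
      by (simp add: comb_seq_def)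
    with nn_integral_split[OF meas, of m] show ?thesis
      by (simp only: m_def stock_comb_seq fst_conv snd_conv prod.collapse)
  qed
  also have "\<dots> = (\<integral>\<^sup>+x. (\<integral>\<^sup>+d. f (max (x + r - d 0) 0) \<partial>S) \<partial>I_inf_law \<D> r)"
    using Suc.prems(1) by (intro Suc.IH) measurable
  also have "\<dots> = (\<integral>\<^sup>+x. f x \<partial>I_inf_law \<D> r)"
    using M_eq by (intro I_inf_law_stationary f) simp
  finally show ?case .
qed

text \<open>A property of the law alone, so it is inherited from \<open>enn2real\<close> by testing
  with the indicator of the negative reals.\<close>

lemma AE_stock_nonneg:
  assumes "n \<le> T"
  shows "AE \<omega> in Omega. 0 \<le> stock \<omega> n"
proof -
  have "(\<integral>\<^sup>+\<omega>. indicator {..<0} (stock \<omega> n) \<partial>Omega) = (\<integral>\<^sup>+x. indicator {..<0} x \<partial>I_inf_law \<D> r)"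
    by (rule nn_integral_stock[OF assms]) measurable
  also have "\<dots> = (\<integral>\<^sup>+\<omega>. indicator {..<0} (enn2real (walk_sup r \<omega>)) \<partial>S)"
    by (rule nn_integral_I_inf_law) measurable
  also have "\<dots> = 0"
    by (simp add: indicator_def not_less[THEN iffD2])
  finally have "AE \<omega> in Omega. indicator {..<0} (stock \<omega> n) = (0 :: ennreal)"
    by (subst (asm) nn_integral_0_iff_AE) auto
  then show ?thesis
    by eventually_elim (simp add: indicator_def split: if_splits)
qed

lemma integrable_stock: "n \<le> T \<Longrightarrow> integrable Omega (\<lambda>\<omega>. stock \<omega> n)"
  and integral_stock: "n \<le> T \<Longrightarrow> (\<integral>\<omega>. stock \<omega> n \<partial>Omega) = M"
proof -
  assume n: "n \<le> T"
  have "(\<integral>\<^sup>+\<omega>. ennreal (stock \<omega> n) \<partial>Omega) = (\<integral>\<^sup>+x. ennreal x \<partial>I_inf_law \<D> r)"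
    by (rule nn_integral_stock[OF n]) measurable
  also have "\<dots> = ennreal M"
    using M_eq by (simp add: nn_integral_I_inf_law_ennreal)
  finally have nn: "(\<integral>\<^sup>+\<omega>. ennreal (stock \<omega> n) \<partial>Omega) = ennreal M" .
  from nn_integral_eq_integrable[THEN iffD1, OF _ AE_stock_nonneg[OF n] _ nn] M_nonneg
  show "integrable Omega (\<lambda>\<omega>. stock \<omega> n)" "(\<integral>\<omega>. stock \<omega> n \<partial>Omega) = M"
    by auto
qed

text \<open>By stationarity the stock terms in the balance for lost demand cancel in the mean,
  leaving \<open>\<mu> - r\<close> per period. The total is thus exact for every horizon.\<close>

lemma constant_order_cost:
  "(\<integral>\<^sup>+\<omega>. ennreal (\<Sum>t=Suc L..T + L. cost h c L T \<pi> \<omega> t) \<partial>Omega) = ennreal (real T * (h * M + c * (\<mu> - r)))"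
proof -
  define g where "g \<omega> n = h * stock \<omega> (Suc n) + c * (stock \<omega> (Suc n) - stock \<omega> n - r + snd \<omega> (Suc L + n))" for \<omega> n
  have eq: "AE \<omega> in Omega. (\<Sum>t=Suc L..T + L. cost h c L T \<pi> \<omega> t) = (\<Sum>n<T. g \<omega> n)"
    using AE_available
  proof eventually_elim
    case (elim \<omega>)
    have "(\<Sum>t=Suc L..T + L. cost h c L T \<pi> \<omega> t) = (\<Sum>n<T. cost h c L T \<pi> \<omega> (Suc L + n))"
      by (rule sum.reindex_bij_witness[of _ "\<lambda>n. Suc L + n" "\<lambda>t. t - Suc L"]) auto
    also have "\<dots> = (\<Sum>n<T. g \<omega> n)"
    proof (rule sum.cong)
      fix n assume "n \<in> {..<T}"
      then have "lost_demand L T \<pi> \<omega> (Suc L + n) = stock \<omega> (Suc n) - stock \<omega> n - r + snd \<omega> (Suc L + n)"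
        using elim lost_demand_balance[of "Suc L + n" L T \<pi> \<omega>] by (auto simp: stock_def[of \<omega> "Suc n"] algebra_simps)
      then show "cost h c L T \<pi> \<omega> (Suc L + n) = g \<omega> n"
        by (simp add: cost_def g_def stock_def[of \<omega> "Suc n"])
    qed simp
    finally show ?case .
  qed
  have g: "integrable Omega (\<lambda>\<omega>. g \<omega> n)" "(\<integral>\<omega>. g \<omega> n \<partial>Omega) = h * M + c * (\<mu> - r)" if "n < T" for n
  proof -
    have n: "n \<le> T" "Suc n \<le> T"
      using that by auto
    note I = integrable_stock[OF n(1)] integrable_stock[OF n(2)] integrable_demand[of "Suc L + n"]
    show "integrable Omega (\<lambda>\<omega>. g \<omega> n)"
      unfolding g_def using I by simp
    show "(\<integral>\<omega>. g \<omega> n \<partial>Omega) = h * M + c * (\<mu> - r)"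
      unfolding g_def using I integral_stock[OF n(1)] integral_stock[OF n(2)] integral_demand[of "Suc L + n"]
      by (simp add: Omega.prob_space)
  qed
  have cost_meas: "(\<lambda>\<omega>. \<Sum>t=Suc L..T + L. cost h c L T \<pi> \<omega> t) \<in> borel_measurable Omega"
    by measurable
  have int_sum: "integrable Omega (\<lambda>\<omega>. \<Sum>n<T. g \<omega> n)"
    using g by (intro Bochner_Integration.integrable_sum) auto
  have int: "integrable Omega (\<lambda>\<omega>. \<Sum>t=Suc L..T + L. cost h c L T \<pi> \<omega> t)"
    using integrable_cong_AE[OF cost_meas borel_measurable_integrable[OF int_sum] eq] int_sum by blast
  have "(\<integral>\<omega>. (\<Sum>t=Suc L..T + L. cost h c L T \<pi> \<omega> t) \<partial>Omega) = (\<integral>\<omega>. (\<Sum>n<T. g \<omega> n) \<partial>Omega)"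
    by (rule integral_cong_AE[OF cost_meas borel_measurable_integrable[OF int_sum] eq])
  also have "\<dots> = real T * (h * M + c * (\<mu> - r))"
    using g by (subst Bochner_Integration.integral_sum) auto
  finally show ?thesis
    using nn_integral_eq_integral[OF int] h_pos c_pos by (simp add: sum_nonneg cost_nonneg)
qed

end

section \<open>Asymptotic optimality\<close>

lemma ennreal_inverse_antimono:
  fixes a b :: ennreal
  assumes "a \<le> b"
  shows "inverse b \<le> inverse a"
proof (cases "a = 0 \<or> b = \<top>")
  case False
  then obtain x y where "a = ennreal x" "0 \<le> x" "b = ennreal y" "0 \<le> y"
    using assms by (metis ennreal_cases top_unique)
  with False assms show ?thesis
    by (auto simp: inverse_ennreal intro!: ennreal_leI le_imp_inverse_le)
qed auto

context lost_sales
begin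

lemma OPT_ge:
  assumes "1 \<le> L" "1 \<le> K" "K \<le> T" "0 \<le> C"
    and "\<And>v. 0 \<le> v \<Longrightarrow> C \<le> window_cost L v + c * \<mu>"
  shows "ennreal (real K * ((real T - real K) * C - h * (real L)\<^sup>2 * \<mu>) / (real K + real L)) \<le> OPT h c \<D> L T"
  unfolding OPT_def
proof (rule INF_greatest)
  fix \<pi> assume "\<pi> \<in> {\<pi>. admissible L \<pi>}"
  then interpret controlled_lost_sales \<D> h c L T \<pi>
    using assms(1) by unfold_locales auto
  show "ennreal (real K * ((real T - real K) * C - h * (real L)\<^sup>2 * \<mu>) / (real K + real L))
      \<le> (\<Sum>t=L+1..T+L. \<integral>\<^sup>+\<omega>. ennreal (cost h c L T \<pi> \<omega> t) \<partial>Omega)"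
    using total_cost_expectation_ge[OF assms(2-)] by (simp add: cost_expectation_def)
qed

definition constant_order_total :: "real \<Rightarrow> nat \<Rightarrow> nat \<Rightarrow> ennreal" where
  "constant_order_total r L T = (\<integral>\<^sup>+\<omega>. ennreal (\<Sum>t=L+1..T+L. cost h c L T (constant_order_policy \<D> r) \<omega> t)
      \<partial>sample_space \<D> (constant_order_policy \<D> r))"

text \<open>\<open>OPT\<close> sums expectations, whereas the total is the expectation of a sum;
  nonnegative costs make the two agree.\<close>

lemma OPT_le_constant_order_total:
  assumes "1 \<le> L" "0 \<le> r"
  shows "OPT h c \<D> L T \<le> constant_order_total r L T"
proof -
  have adm: "admissible L (constant_order_policy \<D> r)"
    by (intro admissible_constant_order_policy prob_D sets_D assms)
  then interpret controlled_demand \<D> L T "constant_order_policy \<D> r"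
    using assms(1) by unfold_locales
  have "constant_order_total r L T =
      (\<integral>\<^sup>+\<omega>. (\<Sum>t=L+1..T+L. ennreal (cost h c L T (constant_order_policy \<D> r) \<omega> t)) \<partial>Omega)"
    unfolding constant_order_total_def using h_pos c_pos by (simp add: sum_ennreal cost_nonneg)
  also have "\<dots> = (\<Sum>t=L+1..T+L. \<integral>\<^sup>+\<omega>. ennreal (cost h c L T (constant_order_policy \<D> r) \<omega> t) \<partial>Omega)"
    by (rule nn_integral_sum) measurable
  finally show ?thesis
    unfolding OPT_def using adm by (auto intro: INF_lower2)
qed

lemma constant_order_total_eq:
  assumes "1 \<le> L" "0 \<le> r" "0 \<le> M" "expected_I_inf \<D> r = ennreal M"
  shows "constant_order_total r L T = ennreal (real T * (h * M + c * (\<mu> - r)))"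
proof -
  interpret constant_order_demand \<D> h c L T r M
    using assms by unfold_locales
  show ?thesis
    using constant_order_cost by (simp add: constant_order_total_def)
qed

text \<open>The lower bound compares the policy with the infimum over a class containing it. For the
  upper bound \<open>T\<close> tends to infinity with \<open>K\<close> fixed, leaving the factor
  \<open>(K + L) / K\<close>, and then \<open>K\<close> tends to infinity.\<close>

lemma limsup_ratio_bounds:
  assumes L: "1 \<le> L" and r: "0 \<le> r" and C: "0 < C" "\<And>v. 0 \<le> v \<Longrightarrow> C \<le> window_cost L v + c * \<mu>"
    and G: "0 \<le> G" "\<And>T. constant_order_total r L T \<le> ennreal (real T * G)"
  shows "1 \<le> limsup (\<lambda>T. constant_order_total r L T / OPT h c \<D> L T)"
    and "limsup (\<lambda>T. constant_order_total r L T / OPT h c \<D> L T) \<le> ennreal (G / C)"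
proof -
  define A where "A = h * (real L)\<^sup>2 * \<mu>"
  define b where "b K T = real K * ((real T - real K) * C - A) / (real K + real L)" for K T
  have b_le: "ennreal (b K T) \<le> OPT h c \<D> L T" if "1 \<le> K" "K \<le> T" for K T
    using OPT_ge[OF L that less_imp_le[OF C(1)] C(2)] by (simp add: b_def A_def)
  have ratio: "(\<lambda>T. real T * G / b K T) \<longlonglongrightarrow> G / C * ((real K + real L) / real K)"
    and b_pos: "\<forall>\<^sub>F T in sequentially. 0 < b K T" if "1 \<le> K" for K
  proof -
    have lim: "(\<lambda>T. b K T / real T) \<longlonglongrightarrow> real K * C / (real K + real L)"
    proof (rule Lim_transform_eventually)
      show "(\<lambda>T. real K * (C - (real K * C + A) / real T) / (real K + real L)) \<longlonglongrightarrow> real K * C / (real K + real L)"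
        using that by (auto intro!: tendsto_eq_intros lim_const_over_n)
      show "\<forall>\<^sub>F T in sequentially. real K * (C - (real K * C + A) / real T) / (real K + real L) = b K T / real T"
        using eventually_gt_at_top[of 0] by eventually_elim (simp add: b_def field_simps)
    qed
    have pos: "0 < real K * C / (real K + real L)"
      using that C by simp
    from order_tendstoD(1)[OF lim pos] show "\<forall>\<^sub>F T in sequentially. 0 < b K T"
      by eventually_elim (simp add: zero_less_divide_iff)
    have "(\<lambda>T. G / (b K T / real T)) \<longlonglongrightarrow> G / (real K * C / (real K + real L))"
      by (intro tendsto_divide[OF tendsto_const lim] less_imp_neq[OF pos, THEN not_sym])
    then show "(\<lambda>T. real T * G / b K T) \<longlonglongrightarrow> G / C * ((real K + real L) / real K)"
      by (simp add: mult.commute)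
  qed
  show "1 \<le> limsup (\<lambda>T. constant_order_total r L T / OPT h c \<D> L T)"
  proof (rule le_Limsup)
    show "\<forall>\<^sub>F T in sequentially. 1 \<le> constant_order_total r L T / OPT h c \<D> L T"
      using b_pos[of 1, OF order_refl] eventually_ge_at_top[of 1]
    proof eventually_elim
      case (elim T)
      have le: "OPT h c \<D> L T \<le> constant_order_total r L T"
        by (rule OPT_le_constant_order_total[OF L r])
      \<comment> \<open>In \<open>ennreal\<close> a number divided by itself is \<open>1\<close>
        only if it is neither \<open>0\<close> nor infinite, so both are excluded; the lower bound
        with \<open>K = 1\<close> gives positivity.\<close>
      have "0 < OPT h c \<D> L T"
        using b_le[OF order_refl elim(2)] elim(1) less_le_trans[of 0 "ennreal (b 1 T)"] by simp
      moreover have "OPT h c \<D> L T < \<top>"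
        using le G(2)[of T] by (metis ennreal_less_top le_less_trans)
      ultimately have "1 = OPT h c \<D> L T / OPT h c \<D> L T"
        by (simp add: ennreal_divide_self)
      also have "\<dots> \<le> constant_order_total r L T / OPT h c \<D> L T"
        by (rule divide_right_mono_ennreal[OF le])
      finally show ?case .
    qed
  qed simp
  have le_K: "limsup (\<lambda>T. constant_order_total r L T / OPT h c \<D> L T)
      \<le> ennreal (G / C * ((real K + real L) / real K))" if "1 \<le> K" for K
  proof -
    have "\<forall>\<^sub>F T in sequentially. constant_order_total r L T / OPT h c \<D> L T \<le> ennreal (real T * G / b K T)"
      using b_pos[OF that] eventually_ge_at_top[of K]
    proof eventually_elim
      case (elim T)
      have "constant_order_total r L T / OPT h c \<D> L T \<le> ennreal (real T * G) / ennreal (b K T)"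
        unfolding divide_ennreal_def
        by (intro mult_mono ennreal_inverse_antimono G b_le that elim) auto
      also have "\<dots> = ennreal (real T * G / b K T)"
        using elim G(1) by (intro divide_ennreal) auto
      finally show ?case .
    qed
    then have "limsup (\<lambda>T. constant_order_total r L T / OPT h c \<D> L T) \<le> limsup (\<lambda>T. ennreal (real T * G / b K T))"
      by (rule Limsup_mono)
    also have "\<dots> = ennreal (G / C * ((real K + real L) / real K))"
      by (intro lim_imp_Limsup tendsto_ennrealI ratio that) simp
    finally show ?thesis .
  qed
  have "(\<lambda>K. G / C * (1 + real L / real K)) \<longlonglongrightarrow> G / C * (1 + 0)"
    by (intro tendsto_intros lim_const_over_n)
  then have "(\<lambda>K. G / C * (1 + real L / real K)) \<longlonglongrightarrow> G / C"
    by simp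
  then have "(\<lambda>K. G / C * ((real K + real L) / real K)) \<longlonglongrightarrow> G / C"
  proof (rule Lim_transform_eventually)
    show "\<forall>\<^sub>F K in sequentially. G / C * (1 + real L / real K) = G / C * ((real K + real L) / real K)"
      using eventually_gt_at_top[of "0::nat"] by eventually_elim (simp add: add_divide_distrib)
  qed
  then have "(\<lambda>K. ennreal (G / C * ((real K + real L) / real K))) \<longlonglongrightarrow> ennreal (G / C)"
    by (rule tendsto_ennrealI)
  then show "limsup (\<lambda>T. constant_order_total r L T / OPT h c \<D> L T) \<le> ennreal (G / C)"
    by (rule LIMSEQ_le_const) (use le_K in blast)
qed

text \<open>For each large \<open>L\<close> the limsup over \<open>T\<close> lies between
  \<open>1\<close> and \<open>G / (l L + c * \<mu>)\<close>, and the denominator converges to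
  \<open>G > 0\<close>.\<close>

lemma best_constant_order_asymptotically_optimal:
  assumes "\<not> (AE x in \<D>. x = \<mu>)"
  shows "(\<lambda>L. limsup (\<lambda>T. constant_order_total (best_constant_order h c \<D>) L T / OPT h c \<D> L T)) \<longlonglongrightarrow> 1"
proof -
  define z where "z = best_constant_order h c \<D>"
  obtain l m n0 where l: "\<And>n v. n0 \<le> n \<Longrightarrow> 0 \<le> v \<Longrightarrow> l n \<le> window_cost n v" "l \<longlonglongrightarrow> m"
    and z: "0 \<le> z" "\<And>n. window_cost n z \<le> m"
    using best_constant_order_limit unfolding z_def by metis
  define G where "G = m + c * \<mu>"
  have "0 < G"
    unfolding G_def by (rule limit_cost_pos[OF assms z])
  have objective: "constant_order_objective h c \<D> z \<le> ereal m"
    using objective_le_iff[OF z(1), of m] z(2) by simp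
  \<comment> \<open>An infinite mean inventory would make the objective infinite, contradicting its
    bound by \<open>m\<close>.\<close>
  obtain M where M: "0 \<le> M" "expected_I_inf \<D> z = ennreal M"
    using objective h_pos by (cases "expected_I_inf \<D> z") (auto simp: constant_order_objective_def)
  have "h * M + c * (\<mu> - z) \<le> G"
    using objective M by (simp add: constant_order_objective_def G_def algebra_simps)
  then have total: "constant_order_total z L T \<le> ennreal (real T * G)" if "1 \<le> L" for L T
    unfolding constant_order_total_eq[OF that z(1) M] by (intro ennreal_leI mult_left_mono) auto
  have lim: "(\<lambda>L. l L + c * \<mu>) \<longlonglongrightarrow> G"
    unfolding G_def by (intro tendsto_add l(2) tendsto_const)
  have ev: "\<forall>\<^sub>F L in sequentially. 1 \<le> L \<and> n0 \<le> L \<and> 0 < l L + c * \<mu>"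
    using order_tendstoD(1)[OF lim \<open>0 < G\<close>] by (intro eventually_conj eventually_ge_at_top)
  show ?thesis
    unfolding z_def[symmetric]
  proof (rule tendsto_sandwich)
    show "\<forall>\<^sub>F L in sequentially. 1 \<le> limsup (\<lambda>T. constant_order_total z L T / OPT h c \<D> L T)"
      using ev
    proof eventually_elim
      case (elim L)
      then show ?case
        using l(1) total \<open>0 < G\<close> z(1) by (intro limsup_ratio_bounds(1)[of L z "l L + c * \<mu>" G]) auto
    qed
    show "\<forall>\<^sub>F L in sequentially. limsup (\<lambda>T. constant_order_total z L T / OPT h c \<D> L T) \<le> ennreal (G / (l L + c * \<mu>))"
      using ev
    proof eventually_elim
      case (elim L)
      then show ?case
        using l(1) total \<open>0 < G\<close> z(1) by (intro limsup_ratio_bounds(2)) auto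
    qed
    have "(\<lambda>L. G / (l L + c * \<mu>)) \<longlonglongrightarrow> G / G"
      using \<open>0 < G\<close> by (intro tendsto_divide tendsto_const lim) simp
    from tendsto_ennrealI[OF this] show "(\<lambda>L. ennreal (G / (l L + c * \<mu>))) \<longlonglongrightarrow> 1"
      using \<open>0 < G\<close> by simp
  qed simp
qed

end

theorem corollary2:
  fixes h c :: real and \<D> :: "real measure"
  assumes "h > 0" and "c > 0"
    and "prob_space \<D>" and "sets \<D> = sets borel"
    and "AE x in \<D>. 0 \<le> x"
    and "integrable \<D> (\<lambda>x. x ^ 3)"
    and "\<not> (\<exists>a. AE x in \<D>. x = a)"
  shows "(\<lambda>L. limsup (\<lambda>T.
            (\<integral>\<^sup>+\<omega>. ennreal (\<Sum>t=L+1..T+L.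
                cost h c L T (constant_order_policy \<D> (best_constant_order h c \<D>)) \<omega> t)
              \<partial>sample_space \<D> (constant_order_policy \<D> (best_constant_order h c \<D>)))
            / OPT h c \<D> L T)) \<longlonglongrightarrow> 1"
proof -
  interpret D: prob_space \<D>
    by fact
  \<comment> \<open>For nonnegative \<open>x\<close> the function \<open>1 + x ^ 3\<close> dominates
    \<open>x\<close>, so the third moment yields a finite mean.\<close>
  have "integrable \<D> (\<lambda>x. 1 + x ^ 3)"
    using assms(6) by simp
  then have "integrable \<D> (\<lambda>x. x)"
  proof (rule Bochner_Integration.integrable_bound)
    show "(\<lambda>x. x) \<in> borel_measurable \<D>"
      using assms(4) by simp
    show "AE x in \<D>. norm x \<le> norm (1 + x ^ 3)"
      using assms(5)
    proof eventually_elim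
      case (elim x)
      have "x \<le> 1 + x ^ 3"
      proof (cases "x \<le> 1")
        case True
        then show ?thesis
          using elim by (simp add: add_increasing2)
      next
        case False
        then show ?thesis
          using self_le_power[of x 3] by simp
      qed
      with elim show ?case
        by simp
    qed
  qed
  then interpret lost_sales \<D> h c
    using assms by unfold_locales auto
  show ?thesis
    using best_constant_order_asymptotically_optimal assms(7) unfolding constant_order_total_def by blast
qed

end
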